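(* Let $a\ge -1$, let $p>1$, and let $F(u)=|u|^{p-1}u$ or $F(u)=|u|^{p}$. Let $f\in C^2(\mathbb{R})$ and $g\in C^1(\mathbb{R})$ satisfy $\|f\|_{L^\infty(\mathbb{R})}<\infty$ and $\|g\|_{L^1(\mathbb{R})}<\infty$. For $\varepsilon>0$ let $T_\varepsilon=T_\varepsilon(f,g)$ denote the lifespan of the $C^2$-solution of the initial value problem $$u_{tt}-u_{xx}=\frac{F(u(x,t))}{(1+|x|^2)^{(1+a)/2}},\quad (x,t)\in\mathbb{R}\times[0,\infty),\qquad u(x,0)=\varepsilon f(x),\quad u_t(x,0)=\varepsilon g(x),\quad x\in\mathbb{R}.$$ Then there exists a positive constant $c=c(f,g,a,p)$ such that $$T_\varepsilon\ge\begin{cases} c\,\varepsilon^{-(p-1)/(1-a)} & \text{if } -1\le a<0,\\ \phi^{-1}\big(c\,\varepsilon^{-(p-1)}\big) & \text{if } a=0,\\ c\,\varepsilon^{-(p-1)} & \text{if } a>0,\end{cases}$$ holds for $\varepsilon>0$, where $\phi(s)=s\log(2+s)$ for $s\ge 0$.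
   Context: The unknown $u=u(x,t)$ is a real scalar function. The lifespan is defined, for arbitrarily fixed $(f,g)\in C^2(\mathbb{R})\times C^1(\mathbb{R})$, by $$T_\varepsilon=T_\varepsilon(f,g):=\sup\{T\in(0,\infty): \text{there exists a unique solution } u\in C^2(\mathbb{R}\times[0,T)) \text{ of the initial value problem}\}$$ (possibly $+\infty$). The function $\phi:[0,\infty)\to[0,\infty)$ is strictly increasing and onto, and $\phi^{-1}$ is its inverse. *)

theory Defs
  imports "HOL-Analysis.Analysis" "HOL-Probability.Essential_Supremum"
begin

(* First partial derivatives on the strip R x [0,T). At t = 0 the time derivative is
   the one-sided one, because it is taken within {0..<T}. *)
definition partials_on_strip ::
  "real \<Rightarrow> (real \<Rightarrow> real \<Rightarrow> real) \<Rightarrow> (real \<Rightarrow> real \<Rightarrow> real) \<Rightarrow> (real \<Rightarrow> real \<Rightarrow> real) \<Rightarrow> bool"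
where
  "partials_on_strip T u ux ut \<longleftrightarrow>
     (\<forall>x. \<forall>t\<in>{0..<T}.
        ((\<lambda>y. u y t) has_real_derivative ux x t) (at x) \<and>
        ((\<lambda>s. u x s) has_real_derivative ut x t) (at t within {0..<T}))"

abbreviation continuous_on_strip :: "real \<Rightarrow> (real \<Rightarrow> real \<Rightarrow> real) \<Rightarrow> bool" where
  "continuous_on_strip T u \<equiv> continuous_on (UNIV \<times> {0..<T}) (\<lambda>(x, t). u x t)"

(* u belongs to C^2(R x [0,T)), and the remaining arguments are its partial derivatives
   of order at most two; for T > 0 they are determined by u on the strip. *)
definition C2_on_strip_with ::
  "real \<Rightarrow> (real \<Rightarrow> real \<Rightarrow> real) \<Rightarrow> (real \<Rightarrow> real \<Rightarrow> real) \<Rightarrow> (real \<Rightarrow> real \<Rightarrow> real) \<Rightarrow>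
   (real \<Rightarrow> real \<Rightarrow> real) \<Rightarrow> (real \<Rightarrow> real \<Rightarrow> real) \<Rightarrow> (real \<Rightarrow> real \<Rightarrow> real) \<Rightarrow>
   (real \<Rightarrow> real \<Rightarrow> real) \<Rightarrow> bool"
where
  "C2_on_strip_with T u ux ut uxx uxt utx utt \<longleftrightarrow>
     partials_on_strip T u ux ut \<and> partials_on_strip T ux uxx uxt \<and>
     partials_on_strip T ut utx utt \<and>
     continuous_on_strip T u \<and> continuous_on_strip T ux \<and> continuous_on_strip T ut \<and>
     continuous_on_strip T uxx \<and> continuous_on_strip T uxt \<and>
     continuous_on_strip T utx \<and> continuous_on_strip T utt"

definition C2_solution ::
  "real \<Rightarrow> (real \<Rightarrow> real) \<Rightarrow> (real \<Rightarrow> real) \<Rightarrow> (real \<Rightarrow> real) \<Rightarrow> real \<Rightarrow> (real \<Rightarrow> real \<Rightarrow> real) \<Rightarrow> bool"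
where
  "C2_solution a F u0 u1 T u \<longleftrightarrow>
     (\<exists>ux ut uxx uxt utx utt.
        C2_on_strip_with T u ux ut uxx uxt utx utt \<and>
        (\<forall>x. \<forall>t\<in>{0..<T}.
           utt x t - uxx x t = F (u x t) / (1 + \<bar>x\<bar>\<^sup>2) powr ((1 + a) / 2)) \<and>
        (\<forall>x. u x 0 = u0 x) \<and> (\<forall>x. ut x 0 = u1 x))"

(* Solutions are total functions, so uniqueness means agreement on R x [0,T). *)
definition unique_C2_solution_exists ::
  "real \<Rightarrow> (real \<Rightarrow> real) \<Rightarrow> (real \<Rightarrow> real) \<Rightarrow> (real \<Rightarrow> real) \<Rightarrow> real \<Rightarrow> bool"
where
  "unique_C2_solution_exists a F u0 u1 T \<longleftrightarrow>
     (\<exists>u. C2_solution a F u0 u1 T u \<and>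
        (\<forall>v. C2_solution a F u0 u1 T v \<longrightarrow> (\<forall>x. \<forall>t\<in>{0..<T}. v x t = u x t)))"

(* The supremum is taken in the extended reals: it may be infinite, and it would be
   minus infinity if there were no admissible T. *)
definition lifespan ::
  "real \<Rightarrow> (real \<Rightarrow> real) \<Rightarrow> (real \<Rightarrow> real) \<Rightarrow> (real \<Rightarrow> real) \<Rightarrow> real \<Rightarrow> ereal"
where
  "lifespan a F f g \<epsilon> =
     (SUP T\<in>{T. 0 < T \<and>
        unique_C2_solution_exists a F (\<lambda>x. \<epsilon> * f x) (\<lambda>x. \<epsilon> * g x) T}. ereal T)"

definition C2_real :: "(real \<Rightarrow> real) \<Rightarrow> bool" where
  "C2_real f \<longleftrightarrow> f C1_differentiable_on UNIV \<and> deriv f C1_differentiable_on UNIV"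

definition Linf_norm :: "(real \<Rightarrow> real) \<Rightarrow> ereal" where
  "Linf_norm f = esssup lborel (\<lambda>x. ereal \<bar>f x\<bar>)"

definition L1_norm :: "(real \<Rightarrow> real) \<Rightarrow> ennreal" where
  "L1_norm g = (\<integral>\<^sup>+ x. ennreal \<bar>g x\<bar> \<partial>lborel)"

definition phi :: "real \<Rightarrow> real" where
  "phi s = s * ln (2 + s)"

definition phi_inv :: "real \<Rightarrow> real" where
  "phi_inv = inv_into {0..} phi"

lemma phi_strict_mono_on: "strict_mono_on {0..} phi"
proof (rule strict_mono_onI)
  fix r s :: real assume "r \<in> {0..}" "s \<in> {0..}" and rs: "r < s"
  then have r: "0 \<le> r" by simp
  have "r * ln (2 + r) \<le> r * ln (2 + s)"
    using r rs by (intro mult_left_mono) auto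
  also have "\<dots> < s * ln (2 + s)"
    using r rs by (intro mult_strict_right_mono) auto
  finally show "phi r < phi s" by (simp add: phi_def)
qed

lemma phi_bij_betw: "bij_betw phi {0..} {0..}"
  unfolding bij_betw_def
proof
  show "inj_on phi {0..}"
    using phi_strict_mono_on by (rule strict_mono_on_imp_inj_on)
  show "phi ` {0..} = {0..}"
  proof (intro equalityI subsetI)
    fix y assume "y \<in> phi ` {0..}"
    then show "y \<in> {0..}" by (auto simp: phi_def)
  next
    fix y :: real assume "y \<in> {0..}"
    then have y: "0 \<le> y" by simp
    have l2: "0 < ln (2::real)" by simp
    define b where "b = y / ln 2"
    have b: "0 \<le> b" using y l2 by (simp add: b_def)
    have "b * ln 2 \<le> b * ln (2 + b)"
      using b by (intro mult_left_mono) auto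
    then have "y \<le> phi b" using l2 by (simp add: b_def phi_def)
    moreover have "continuous_on {0..b} phi"
      unfolding phi_def by (intro continuous_intros) auto
    ultimately obtain s where "0 \<le> s" "s \<le> b" "phi s = y"
      using IVT'[of phi 0 y b] y b by (auto simp: phi_def)
    then show "y \<in> phi ` {0..}" by auto
  qed
qed

end

theory Submission
  imports Defs
begin

text \<open>
The Cauchy problem is solved by the contraction principle, and the lifespan bound is the condition
under which the contraction works. Write \<open>w\<close> for the weight \<open>(1 + x\<^sup>2) powr (- (1 + a) / 2)\<close>. The free
solution with the data \<open>\<epsilon> f, \<epsilon> g\<close> is \<open>\<epsilon> (P (x + t) + Q (x - t))\<close> by d'Alembert's formula, and it is
at most \<open>\<epsilon> M\<close> in absolute value, where \<open>M\<close> depends only on the norms of \<open>f\<close> and \<open>g\<close>. The source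
contributes one half of the integral of \<open>F (u) w\<close> over the backward triangle. If \<open>|u| \<le> 2 \<epsilon> M\<close>, this
is at most \<open>T S(T) L (2 \<epsilon> M)\<close> for times up to \<open>T\<close>, where \<open>2 S(T)\<close> bounds the integral of \<open>w\<close> over every interval of
length \<open>2 T\<close> and \<open>L = p (2 \<epsilon> M) powr (p - 1)\<close> is the Lipschitz constant of \<open>F\<close> on the ball. So
\<open>T S(T) L \<le> 1/2\<close> gives a fixed point, and this is a condition \<open>T S(T) \<le> const \<cdot> \<epsilon> powr (- (p - 1))\<close>.
The three cases of the theorem are the three growth rates of \<open>S\<close>: \<open>S(T)\<close> is of order
\<open>T powr (- a)\<close> for \<open>a < 0\<close>, \<open>ln (2 + T)\<close> for \<open>a = 0\<close>, and bounded for \<open>a > 0\<close>.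

A fixed point in the space of bounded continuous functions is of class \<open>C\<^sup>2\<close> because Duhamel's integral
gains a derivative twice. For a source \<open>h\<close> that is only continuous, write the triangle integral
as a difference of two integrals along characteristics of an \<open>x\<close>-antiderivative of \<open>h\<close>; such an
integral can be differentiated in \<open>t\<close> using the \<open>x\<close>-derivative of its integrand alone, so the
fixed point is \<open>C\<^sup>1\<close>. Then \<open>h\<close> itself has a continuous \<open>x\<close>-derivative, and the same fact gives
\<open>C\<^sup>2\<close> (\<open>has_dt_char_int\<close>, \<open>semilinear_wave_existence\<close>).

The lifespan asks for uniqueness among all \<open>C\<^sup>2\<close> solutions, including unbounded ones. It is local: on a
compact backward cone two solutions are bounded, so their difference \<open>d\<close> satisfies
\<open>|d\<^sub>t\<^sub>t - d\<^sub>x\<^sub>x| \<le> K |d|\<close> there. Factoring the wave operator into two transport operators and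
weighting with an exponential in time forces \<open>d = 0\<close> (\<open>wave_zero_data_imp_zero\<close>).
\<close>

section \<open>Signed primitives and the chain rule\<close>

text \<open>The integral of \<open>k\<close> from \<open>0\<close> to \<open>x\<close>, with sign for negative \<open>x\<close>. Rescaling to a fixed
interval avoids the case distinction on the sign of \<open>x\<close> and lets continuity and differentiation
under the integral sign apply directly when \<open>k\<close> depends on parameters.\<close>
definition prim :: "(real \<Rightarrow> real) \<Rightarrow> real \<Rightarrow> real" where
  "prim k x = x * integral {0..1} (\<lambda>s. k (x * s))"

lemma antiderivative_exists:
  fixes k :: "real \<Rightarrow> real"
  assumes "continuous_on UNIV k"
  obtains K where "\<And>x. (K has_real_derivative k x) (at x)"
proof -
  have "\<exists>F. \<forall>x :: real. -\<infinity> < ereal x \<longrightarrow> ereal x < \<infinity> \<longrightarrow> (F has_vector_derivative k x) (at x)"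
    using assms by (intro einterval_antiderivative) (auto simp: continuous_on_eq_continuous_at)
  then show thesis
    using that by (auto simp: has_real_derivative_iff_has_vector_derivative)
qed

lemma prim_eq_increment:
  assumes K: "\<And>x. (K has_real_derivative k x) (at x)"
  shows "prim k x = K x - K 0"
proof -
  have "((\<lambda>s. x * k (x * s)) has_integral (K (x * 1) - K (x * 0))) {0..1}"
  proof (rule fundamental_theorem_of_calculus)
    fix s :: real
    have "((\<lambda>s. K (x * s)) has_real_derivative k (x * s) * x) (at s within {0..1})"
      by (rule DERIV_chain'[where g = K, OF _ K]) (auto intro!: derivative_eq_intros)
    then show "((\<lambda>s. K (x * s)) has_vector_derivative x * k (x * s)) (at s within {0..1})"
      by (simp add: has_real_derivative_iff_has_vector_derivative mult.commute)
  qed simp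
  then show ?thesis
    by (simp add: prim_def integral_unique flip: integral_mult_right)
qed

lemma prim_zero [simp]: "prim k 0 = 0"
  by (simp add: prim_def)

lemma DERIV_prim:
  assumes "continuous_on UNIV k"
  shows "(prim k has_real_derivative k x) (at x)"
proof -
  obtain K where K: "\<And>x. (K has_real_derivative k x) (at x)"
    using antiderivative_exists[OF assms] by blast
  have "((\<lambda>x. K x - K 0) has_real_derivative k x) (at x)"
    by (auto intro!: derivative_eq_intros K)
  moreover have "prim k = (\<lambda>x. K x - K 0)"
    using prim_eq_increment[OF K] by blast
  ultimately show ?thesis by simp
qed

lemma prim_diff:
  assumes "continuous_on UNIV k" "continuous_on UNIV l"
  shows "prim (\<lambda>s. k s - l s) x = prim k x - prim l x"
proof -
  have "((\<lambda>s. prim k s - prim l s) has_real_derivative k x - l x) (at x)" for x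
    by (intro DERIV_diff DERIV_prim assms)
  from prim_eq_increment[OF this] show ?thesis by simp
qed

text \<open>The comparison form of the mean value inequality: it replaces integral estimates by
derivative estimates, both for antiderivatives here and along characteristics later.\<close>
lemma increment_bound:
  fixes k K W w :: "real \<Rightarrow> real"
  assumes "a \<le> b" and "continuous_on {a..b} K" and "continuous_on {a..b} W"
    and "\<And>x. a < x \<Longrightarrow> x < b \<Longrightarrow> (K has_real_derivative k x) (at x)"
    and "\<And>x. a < x \<Longrightarrow> x < b \<Longrightarrow> (W has_real_derivative w x) (at x)"
    and "\<And>x. a < x \<Longrightarrow> x < b \<Longrightarrow> \<bar>k x\<bar> \<le> w x"
  shows "\<bar>K b - K a\<bar> \<le> W b - W a"
proof (cases "a = b")
  case False
  with \<open>a \<le> b\<close> have "a < b" by simp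
  from differentiable_bound_general[OF this assms(2,3), of k w] show ?thesis
    using assms(4-6) by (auto simp: has_real_derivative_iff_has_vector_derivative)
qed simp

lemma prim_bound:
  assumes "continuous_on UNIV k" and "0 \<le> x" and "\<And>s. 0 < s \<Longrightarrow> s < x \<Longrightarrow> \<bar>k s\<bar> \<le> m"
  shows "\<bar>prim k x\<bar> \<le> m * x"
proof -
  have D: "(prim k has_real_derivative k s) (at s)" for s
    by (rule DERIV_prim[OF assms(1)])
  then have "continuous_on {0..x} (prim k)"
    by (meson DERIV_isCont continuous_at_imp_continuous_on)
  then have "\<bar>prim k x - prim k 0\<bar> \<le> m * x - m * 0"
    using assms D
    by (intro increment_bound[where k = k and w = "\<lambda>_. m"])
       (auto intro!: continuous_intros derivative_eq_intros)
  then show ?thesis by simp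
qed

lemma continuous_prim_param:
  fixes k :: "'p::topological_space \<Rightarrow> real \<Rightarrow> real"
  assumes "continuous_on UNIV (\<lambda>(p, x). k p x)"
  shows "continuous_on UNIV (\<lambda>(p, x). prim (k p) x)"
proof -
  have "continuous_on (UNIV \<times> cbox 0 1) (\<lambda>((p, x), s::real). k p (x * s))"
    unfolding split_beta
    by (rule continuous_on_compose2[OF assms[unfolded split_beta], where f = "\<lambda>q. (fst (fst q), snd (fst q) * snd q)", simplified])
       (intro continuous_intros)
  then have "continuous_on (UNIV \<times> cbox 0 1) (\<lambda>(q, s::real). k (fst q) (snd q * s))"
    by (simp add: split_beta)
  from integral_continuous_on_param[OF this]
  have "continuous_on UNIV (\<lambda>q. integral {0..1} (\<lambda>s. k (fst q) (snd q * s)))"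
    by simp
  then show ?thesis
    unfolding prim_def split_beta by (intro continuous_intros)
qed

lemma DERIV_prim_param:
  assumes k: "continuous_on UNIV (\<lambda>(z, x). k z x)" and k': "continuous_on UNIV (\<lambda>(z, x). k' z x)"
    and D: "\<And>z x. ((\<lambda>z. k z x) has_real_derivative k' z x) (at z)"
  shows "((\<lambda>z. prim (k z) x) has_real_derivative prim (k' z) x) (at z)"
proof -
  have "((\<lambda>z. integral (cbox 0 1) (\<lambda>s. k z (x * s))) has_real_derivative
          integral (cbox 0 1) (\<lambda>s. k' z (x * s))) (at z within UNIV)"
  proof (rule leibniz_rule_field_derivative)
    show "(\<lambda>s. k z (x * s)) integrable_on cbox 0 1" for z
      by (intro integrable_continuous continuous_on_compose2[OF k, where f = "\<lambda>s. (z, x * s)", simplified] continuous_intros)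
    show "continuous_on (UNIV \<times> cbox 0 1) (\<lambda>(z, s). k' z (x * s))"
      unfolding split_beta
      by (rule continuous_on_compose2[OF k'[unfolded split_beta], where f = "\<lambda>q. (fst q, x * snd q)", simplified])
         (intro continuous_intros)
  qed (use D in auto)
  then show ?thesis
    unfolding prim_def by (auto intro!: derivative_eq_intros)
qed

text \<open>Only one of the two partial derivatives has to be continuous, which is why \<open>x\<close>-regularity
of a source will suffice for differentiating Duhamel's integral in time. The set \<open>S\<close> is the whole
line for the existence part and an open time interval for the uniqueness part.\<close>
lemma DERIV_two_variable_chain:
  fixes K :: "real \<Rightarrow> real \<Rightarrow> real"
  assumes S: "open S" "convex S" "\<beta> t \<in> S"
    and Kx: "((\<lambda>x. K x (\<beta> t)) has_real_derivative Kx) (at (\<alpha> t))"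
    and Kt: "\<And>x s. s \<in> S \<Longrightarrow> ((\<lambda>s. K x s) has_real_derivative Kt x s) (at s)"
    and cont: "continuous_on (UNIV \<times> S) (\<lambda>(x, s). Kt x s)"
    and \<alpha>: "(\<alpha> has_real_derivative \<alpha>') (at t)" and \<beta>: "(\<beta> has_real_derivative \<beta>') (at t)"
  shows "((\<lambda>t. K (\<alpha> t) (\<beta> t)) has_real_derivative Kx * \<alpha>' + Kt (\<alpha> t) (\<beta> t) * \<beta>') (at t)"
proof -
  have op: "open (UNIV \<times> S :: (real \<times> real) set)" using S by (intro open_Times) auto
  have "((\<lambda>(x, s). K x s) has_derivative
     (\<lambda>(tx, ts). Kx * tx + blinfun_mult_right (Kt (\<alpha> t) (\<beta> t)) ts)) (at (\<alpha> t, \<beta> t) within UNIV \<times> S)"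
  proof (rule has_derivative_partialsI)
    show "continuous (at (\<alpha> t, \<beta> t) within UNIV \<times> S) (\<lambda>(x, y). blinfun_mult_right (Kt x y))"
      unfolding split_beta
      using cont S unfolding split_beta continuous_on_eq_continuous_within
      by (intro bounded_linear.continuous[OF bounded_linear_blinfun_mult_right]) auto
  qed (use Kx Kt S in \<open>auto simp: has_field_derivative_def intro: has_derivative_at_withinI\<close>)
  then have D: "((\<lambda>q. K (fst q) (snd q)) has_derivative
     (\<lambda>q. Kx * fst q + Kt (\<alpha> t) (\<beta> t) * snd q)) (at (\<alpha> t, \<beta> t))"
    using S at_within_open[OF _ op, of "(\<alpha> t, \<beta> t)"] by (simp add: case_prod_unfold)
  have "((\<lambda>t. (\<alpha> t, \<beta> t)) has_derivative (\<lambda>h. (\<alpha>' * h, \<beta>' * h))) (at t)"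
    using \<alpha> \<beta> unfolding has_field_derivative_def by (rule has_derivative_Pair)
  from has_derivative_compose[OF this D]
  have "((\<lambda>t. K (\<alpha> t) (\<beta> t)) has_derivative
      (\<lambda>h. Kx * (\<alpha>' * h) + Kt (\<alpha> t) (\<beta> t) * (\<beta>' * h))) (at t)"
    by simp
  moreover have "(\<lambda>h. Kx * (\<alpha>' * h) + Kt (\<alpha> t) (\<beta> t) * (\<beta>' * h))
      = (*) (Kx * \<alpha>' + Kt (\<alpha> t) (\<beta> t) * \<beta>')"
    by (simp add: fun_eq_iff algebra_simps)
  ultimately show ?thesis
    by (simp add: has_field_derivative_def)
qed

section \<open>Duhamel's formula on the line\<close>

abbreviation cont2 :: "(real \<Rightarrow> real \<Rightarrow> real) \<Rightarrow> bool" where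
  "cont2 \<phi> \<equiv> continuous_on UNIV (\<lambda>(x, t). \<phi> x t)"

abbreviation has_dx :: "(real \<Rightarrow> real \<Rightarrow> real) \<Rightarrow> (real \<Rightarrow> real \<Rightarrow> real) \<Rightarrow> bool" where
  "has_dx \<phi> \<phi>x \<equiv> \<forall>x t. ((\<lambda>y. \<phi> y t) has_real_derivative \<phi>x x t) (at x)"

abbreviation has_dt :: "(real \<Rightarrow> real \<Rightarrow> real) \<Rightarrow> (real \<Rightarrow> real \<Rightarrow> real) \<Rightarrow> bool" where
  "has_dt \<phi> \<phi>t \<equiv> \<forall>x t. ((\<lambda>s. \<phi> x s) has_real_derivative \<phi>t x t) (at t)"

lemma cont2_compose:
  assumes "cont2 \<phi>" and "continuous_on S \<alpha>" and "continuous_on S \<beta>"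
  shows "continuous_on S (\<lambda>q. \<phi> (\<alpha> q) (\<beta> q))"
  using continuous_on_compose2[OF assms(1), of S "\<lambda>q. (\<alpha> q, \<beta> q)"] assms(2,3)
  by (auto intro: continuous_on_Pair)

text \<open>The integral of \<open>\<phi>\<close> from time \<open>0\<close> to time \<open>t\<close> along the line that reaches \<open>(x, t)\<close>
with \<open>dx/dt = - \<sigma>\<close>. It is the solution of \<open>v\<^sub>t - \<sigma> v\<^sub>x = \<phi>\<close> with zero data.\<close>
definition char_int :: "real \<Rightarrow> (real \<Rightarrow> real \<Rightarrow> real) \<Rightarrow> real \<Rightarrow> real \<Rightarrow> real" where
  "char_int \<sigma> \<phi> x t = prim (\<lambda>s. \<phi> (x + \<sigma> * (t - s)) s) t"

lemma char_int_zero [simp]: "char_int \<sigma> \<phi> x 0 = 0"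
  by (simp add: char_int_def)

lemma cont2_char_int:
  assumes "cont2 \<phi>"
  shows "cont2 (char_int \<sigma> \<phi>)"
proof -
  have "continuous_on UNIV (\<lambda>(p, s). \<phi> (fst p + \<sigma> * (snd p - s)) s)"
    unfolding case_prod_unfold by (intro cont2_compose[OF assms] continuous_intros)
  from continuous_prim_param[OF this]
  have "continuous_on UNIV (\<lambda>q. prim (\<lambda>s. \<phi> (fst (fst q) + \<sigma> * (snd (fst q) - s)) s) (snd q))"
    by (simp add: case_prod_unfold)
  from continuous_on_compose2[OF this, of UNIV "\<lambda>q. (q, snd q)"] show ?thesis
    unfolding char_int_def case_prod_unfold
    by (simp add: continuous_on_Pair continuous_on_id continuous_on_snd)
qed

lemma has_dx_char_int:
  assumes "cont2 \<phi>" "cont2 \<phi>x" "has_dx \<phi> \<phi>x"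
  shows "has_dx (char_int \<sigma> \<phi>) (char_int \<sigma> \<phi>x)"
proof (intro allI)
  fix x t
  have "continuous_on UNIV (\<lambda>(z, s). \<phi> (z + \<sigma> * (t - s)) s)"
       "continuous_on UNIV (\<lambda>(z, s). \<phi>x (z + \<sigma> * (t - s)) s)"
    unfolding case_prod_unfold by (intro cont2_compose[OF assms(1)] cont2_compose[OF assms(2)] continuous_intros)+
  moreover have "((\<lambda>z. \<phi> (z + \<sigma> * (t - s)) s) has_real_derivative \<phi>x (z + \<sigma> * (t - s)) s) (at z)" for z s
    by (rule DERIV_shift[of "\<lambda>z. \<phi> z s", THEN iffD1, OF assms(3)[rule_format]])
  ultimately show "((\<lambda>y. char_int \<sigma> \<phi> y t) has_real_derivative char_int \<sigma> \<phi>x x t) (at x)"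
    unfolding char_int_def by (rule DERIV_prim_param)
qed

text \<open>Along the line, the integrand at time \<open>s\<close> depends on \<open>x\<close> and \<open>t\<close> only through
\<open>z = x + \<sigma> t\<close>. So the integral is a function of \<open>z\<close> and of its upper limit, and no
\<open>t\<close>-derivative of \<open>\<phi>\<close> enters.\<close>
lemma has_dt_char_int:
  assumes "cont2 \<phi>" "cont2 \<phi>x" "has_dx \<phi> \<phi>x"
  shows "has_dt (char_int \<sigma> \<phi>) (\<lambda>x t. \<phi> x t + \<sigma> * char_int \<sigma> \<phi>x x t)"
proof (intro allI)
  fix x t
  define K where "K z s = prim (\<lambda>r. \<phi> (z - \<sigma> * r) r) s" for z s
  have c: "continuous_on UNIV (\<lambda>(z, r). \<phi> (z - \<sigma> * r) r)"
       "continuous_on UNIV (\<lambda>(z, r). \<phi>x (z - \<sigma> * r) r)"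
    unfolding case_prod_unfold by (intro cont2_compose[OF assms(1)] cont2_compose[OF assms(2)] continuous_intros)+
  have d: "((\<lambda>z. \<phi> (z - \<sigma> * r) r) has_real_derivative \<phi>x (z - \<sigma> * r) r) (at z)" for z r
    using DERIV_shift[of "\<lambda>z. \<phi> z r" _ z "- \<sigma> * r", THEN iffD1, OF assms(3)[rule_format]] by simp
  have K1: "((\<lambda>z. K z s) has_real_derivative prim (\<lambda>r. \<phi>x (z - \<sigma> * r) r) s) (at z)" for z s
    unfolding K_def by (rule DERIV_prim_param[OF c d])
  have K2: "((\<lambda>s. K z s) has_real_derivative \<phi> (z - \<sigma> * s) s) (at s)" for z s
    unfolding K_def by (intro DERIV_prim cont2_compose[OF assms(1)] continuous_intros)
  have "((\<lambda>t. K (x + \<sigma> * t) t) has_real_derivative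
          prim (\<lambda>r. \<phi>x (x + \<sigma> * t - \<sigma> * r) r) t * \<sigma> + \<phi> (x + \<sigma> * t - \<sigma> * t) t * 1) (at t)"
  proof (rule DERIV_two_variable_chain[where S = UNIV, OF _ _ _ K1 K2])
    show "((\<lambda>t. x + \<sigma> * t) has_real_derivative \<sigma>) (at t)"
      by (auto intro!: derivative_eq_intros)
    show "continuous_on (UNIV \<times> UNIV) (\<lambda>(z, r). \<phi> (z - \<sigma> * r) r)"
      using c(1) by simp
  qed simp_all
  then show "((\<lambda>s. char_int \<sigma> \<phi> x s) has_real_derivative \<phi> x t + \<sigma> * char_int \<sigma> \<phi>x x t) (at t)"
    by (simp add: K_def char_int_def algebra_simps)
qed

definition xprim :: "(real \<Rightarrow> real \<Rightarrow> real) \<Rightarrow> real \<Rightarrow> real \<Rightarrow> real" where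
  "xprim h x t = prim (\<lambda>y. h y t) x"

lemma cont2_xprim:
  assumes "cont2 h"
  shows "cont2 (xprim h)"
proof -
  have "continuous_on UNIV (\<lambda>(t, y). h y t)"
    unfolding case_prod_unfold by (intro cont2_compose[OF assms] continuous_intros)
  from cont2_compose[OF continuous_prim_param[OF this], of UNIV snd fst]
  show ?thesis
    unfolding xprim_def case_prod_unfold by (simp add: continuous_on_fst continuous_on_snd continuous_on_id)
qed

lemma has_dx_xprim: "cont2 h \<Longrightarrow> has_dx (xprim h) h"
  unfolding xprim_def by (intro allI DERIV_prim cont2_compose[of h] continuous_intros)

text \<open>Equal to one half of the integral of \<open>h\<close> over the triangle with vertex \<open>(x, t)\<close> and base
\<open>[x - t, x + t]\<close>: the inner integral over \<open>x\<close> is a difference of values of the antiderivative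
\<open>xprim h\<close>. In this form a source that is merely continuous yields a \<open>C\<^sup>1\<close> function.\<close>
definition duhamel :: "(real \<Rightarrow> real \<Rightarrow> real) \<Rightarrow> real \<Rightarrow> real \<Rightarrow> real" where
  "duhamel h x t = (char_int 1 (xprim h) x t - char_int (-1) (xprim h) x t) / 2"

definition duhamel_dx :: "(real \<Rightarrow> real \<Rightarrow> real) \<Rightarrow> real \<Rightarrow> real \<Rightarrow> real" where
  "duhamel_dx h x t = (char_int 1 h x t - char_int (-1) h x t) / 2"

definition duhamel_dt :: "(real \<Rightarrow> real \<Rightarrow> real) \<Rightarrow> real \<Rightarrow> real \<Rightarrow> real" where
  "duhamel_dt h x t = (char_int 1 h x t + char_int (-1) h x t) / 2"

lemma duhamel_zero [simp]: "duhamel h x 0 = 0" "duhamel_dt h x 0 = 0"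
  by (simp_all add: duhamel_def duhamel_dt_def)

lemma cont2_duhamel:
  assumes "cont2 h"
  shows "cont2 (duhamel h)" "cont2 (duhamel_dx h)" "cont2 (duhamel_dt h)"
  unfolding duhamel_def duhamel_dx_def duhamel_dt_def case_prod_unfold
  by (intro continuous_intros cont2_compose[OF cont2_char_int] cont2_xprim assms; simp)+

lemma has_dx_duhamel:
  assumes "cont2 h"
  shows "has_dx (duhamel h) (duhamel_dx h)"
proof (intro allI)
  fix x t
  note X = has_dx_char_int[OF cont2_xprim[OF assms] assms has_dx_xprim[OF assms], rule_format]
  show "((\<lambda>y. duhamel h y t) has_real_derivative duhamel_dx h x t) (at x)"
    unfolding duhamel_def duhamel_dx_def by (intro DERIV_cdivide DERIV_diff X)
qed

lemma has_dt_duhamel: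
  assumes "cont2 h"
  shows "has_dt (duhamel h) (duhamel_dt h)"
proof (intro allI)
  fix x t
  note T = has_dt_char_int[OF cont2_xprim[OF assms] assms has_dx_xprim[OF assms], rule_format]
  have "((\<lambda>s. duhamel h x s) has_real_derivative
      ((xprim h x t + 1 * char_int 1 h x t) - (xprim h x t + - 1 * char_int (- 1) h x t)) / 2) (at t)"
    unfolding duhamel_def by (intro DERIV_cdivide DERIV_diff T)
  then show "((\<lambda>s. duhamel h x s) has_real_derivative duhamel_dt h x t) (at t)"
    by (simp add: duhamel_dt_def)
qed

lemma second_derivatives_duhamel:
  assumes "cont2 h" "cont2 hx" "has_dx h hx"
  shows "has_dx (duhamel_dx h) (duhamel_dx hx)" "has_dt (duhamel_dx h) (duhamel_dt hx)"
    and "has_dx (duhamel_dt h) (duhamel_dt hx)" "has_dt (duhamel_dt h) (\<lambda>x t. h x t + duhamel_dx hx x t)"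
proof -
  note X = has_dx_char_int[OF assms, rule_format] and T = has_dt_char_int[OF assms, rule_format]
  show "has_dx (duhamel_dx h) (duhamel_dx hx)" "has_dx (duhamel_dt h) (duhamel_dt hx)"
    unfolding duhamel_dx_def duhamel_dt_def
    by (intro allI DERIV_cdivide DERIV_diff DERIV_add X)+
  have "((\<lambda>s. duhamel_dx h x s) has_real_derivative
      ((h x t + 1 * char_int 1 hx x t) - (h x t + - 1 * char_int (- 1) hx x t)) / 2) (at t)"
    "((\<lambda>s. duhamel_dt h x s) has_real_derivative
      ((h x t + 1 * char_int 1 hx x t) + (h x t + - 1 * char_int (- 1) hx x t)) / 2) (at t)" for x t
    unfolding duhamel_dx_def duhamel_dt_def by (intro DERIV_cdivide DERIV_diff DERIV_add T)+
  then show "has_dt (duhamel_dx h) (duhamel_dt hx)" "has_dt (duhamel_dt h) (\<lambda>x t. h x t + duhamel_dx hx x t)"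
    by (simp_all add: duhamel_dx_def duhamel_dt_def field_simps)
qed

lemma duhamel_eq:
  assumes "cont2 h"
  shows "duhamel h x t = prim (\<lambda>s. xprim h (x + (t - s)) s - xprim h (x - (t - s)) s) t / 2"
proof -
  have "x + 1 * (t - s) = x + (t - s)" "x + - 1 * (t - s) = x - (t - s)" for s
    by simp_all
  note e = this
  show ?thesis
    unfolding duhamel_def char_int_def e
    by (subst prim_diff; intro cont2_compose[OF cont2_xprim[OF assms]] continuous_intros refl)
qed

lemma duhamel_diff:
  assumes "cont2 h" "cont2 k"
  shows "duhamel (\<lambda>x t. h x t - k x t) x t = duhamel h x t - duhamel k x t"
proof -
  have e1: "xprim (\<lambda>x t. h x t - k x t) = (\<lambda>x t. xprim h x t - xprim k x t)"
    unfolding xprim_def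
    by (intro ext prim_diff cont2_compose[of h] cont2_compose[of k] assms continuous_intros)
  have e2: "char_int \<sigma> (\<lambda>x t. xprim h x t - xprim k x t) x t
      = char_int \<sigma> (xprim h) x t - char_int \<sigma> (xprim k) x t" for \<sigma>
    unfolding char_int_def
    by (intro prim_diff cont2_compose[OF cont2_xprim] assms continuous_intros)
  show ?thesis
    unfolding duhamel_def e1 e2 by (simp add: diff_divide_distrib)
qed

text \<open>The triangle has height \<open>t\<close>, and each of its horizontal sections carries at most the mass
\<open>2 * S\<close> of the weight.\<close>
lemma duhamel_bound:
  assumes "cont2 h" and "0 \<le> t" and "0 \<le> m"
    and h: "\<And>y s. \<bar>h y s\<bar> \<le> m * w y"
    and W: "\<And>y. (W has_real_derivative w y) (at y)"
    and S: "\<And>r. 0 \<le> r \<Longrightarrow> r \<le> t \<Longrightarrow> W (x + r) - W (x - r) \<le> 2 * S"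
  shows "\<bar>duhamel h x t\<bar> \<le> m * S * t"
proof -
  have "\<bar>prim (\<lambda>s. xprim h (x + (t - s)) s - xprim h (x - (t - s)) s) t\<bar> \<le> (m * (2 * S)) * t"
  proof (rule prim_bound)
    show "continuous_on UNIV (\<lambda>s. xprim h (x + (t - s)) s - xprim h (x - (t - s)) s)"
      by (intro continuous_intros cont2_compose[OF cont2_xprim[OF assms(1)]])
    fix s assume s: "0 < s" "s < t"
    have H: "((\<lambda>y. xprim h y s) has_real_derivative h y s) (at y)" for y
      using has_dx_xprim[OF assms(1)] by simp
    have "\<bar>xprim h (x + (t - s)) s - xprim h (x - (t - s)) s\<bar>
        \<le> m * W (x + (t - s)) - m * W (x - (t - s))"
    proof (rule increment_bound[where k = "\<lambda>y. h y s" and w = "\<lambda>y. m * w y"])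
      show "continuous_on {x - (t - s)..x + (t - s)} (\<lambda>y. xprim h y s)"
        using DERIV_isCont[OF H] by (rule continuous_at_imp_continuous_on[rule_format])
      show "continuous_on {x - (t - s)..x + (t - s)} (\<lambda>y. m * W y)"
        using DERIV_isCont[OF DERIV_cmult[OF W]] by (rule continuous_at_imp_continuous_on[rule_format])
      show "x - (t - s) \<le> x + (t - s)" using s by simp
    qed (rule H DERIV_cmult[OF W] h)+
    also have "\<dots> \<le> m * (2 * S)"
      using S[of "t - s"] s \<open>0 \<le> m\<close> by (simp add: mult_left_mono flip: right_diff_distrib)
    finally show "\<bar>xprim h (x + (t - s)) s - xprim h (x - (t - s)) s\<bar> \<le> m * (2 * S)" .
  qed fact
  then show ?thesis by (simp add: duhamel_eq[OF assms(1)] abs_mult)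
qed

section \<open>Uniqueness on backward light cones\<close>

lemma partials_on_strip_interior:
  assumes "partials_on_strip T u ux ut" and "0 < t" and "t < T"
  shows "((\<lambda>y. u y t) has_real_derivative ux x t) (at x)"
    and "((\<lambda>s. u x s) has_real_derivative ut x t) (at t)"
proof -
  show "((\<lambda>y. u y t) has_real_derivative ux x t) (at x)"
    using assms by (auto simp: partials_on_strip_def)
  have "((\<lambda>s. u x s) has_real_derivative ut x t) (at t within {0..<T})"
    using assms by (auto simp: partials_on_strip_def)
  then have "((\<lambda>s. u x s) has_real_derivative ut x t) (at t within {0<..<T})"
    by (rule DERIV_subset) auto
  then show "((\<lambda>s. u x s) has_real_derivative ut x t) (at t)"
    using assms at_within_open[of t "{0<..<T}"] by simp
qed

text \<open>Schwarz's theorem. The second difference of \<open>u\<close> over a small square equals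
\<open>h\<^sup>2\<close> times a value of either mixed derivative at some point of the square; if the two differed at
the corner, continuity would keep these values apart.\<close>
lemma mixed_partials_eq:
  assumes u: "partials_on_strip T u ux ut" and ux: "partials_on_strip T ux uxx uxt"
    and ut: "partials_on_strip T ut utx utt"
    and cont: "continuous_on_strip T uxt" "continuous_on_strip T utx"
    and t: "0 < t" "t < T"
  shows "uxt x t = utx x t"
proof (rule ccontr)
  define e where "e = \<bar>uxt x t - utx x t\<bar> / 2"
  assume "uxt x t \<noteq> utx x t"
  then have e: "0 < e" by (simp add: e_def)
  have near: "\<exists>d>0. \<forall>y s. \<bar>y - x\<bar> < d \<longrightarrow> \<bar>s - t\<bar> < d \<longrightarrow> \<bar>v y s - v x t\<bar> < e"
    if "continuous_on_strip T v" for v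
  proof -
    have op: "open (UNIV \<times> {0<..<T} :: (real \<times> real) set)" by (intro open_Times) auto
    have "(x, t) \<in> UNIV \<times> {0<..<T}" using t by simp
    have "continuous_on (UNIV \<times> {0<..<T}) (\<lambda>(x, t). v x t)"
      using that by (rule continuous_on_subset) auto
    then have "isCont (\<lambda>(x, t). v x t) (x, t)"
      using continuous_on_eq_continuous_at[OF op] \<open>(x, t) \<in> UNIV \<times> {0<..<T}\<close> by blast
    then obtain d where d: "0 < d"
      "\<And>q. dist q (x, t) < d \<Longrightarrow> dist (case q of (x, t) \<Rightarrow> v x t) (v x t) < e"
      using e unfolding continuous_at_eps_delta by auto
    have "\<bar>v y s - v x t\<bar> < e" if "\<bar>y - x\<bar> < d / 2" "\<bar>s - t\<bar> < d / 2" for y s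
    proof -
      have "dist (y, s) (x, t) \<le> \<bar>y - x\<bar> + \<bar>s - t\<bar>"
        unfolding dist_Pair_Pair dist_real_def by (rule sqrt_sum_squares_le_sum) auto
      also have "\<dots> < d" using that by simp
      finally show ?thesis using d(2)[of "(y, s)"] by (simp add: dist_real_def)
    qed
    then show ?thesis using d(1) by (intro exI[of _ "d / 2"]) auto
  qed
  obtain d1 d2 where d: "0 < d1" "0 < d2"
    "\<And>y s. \<bar>y - x\<bar> < d1 \<Longrightarrow> \<bar>s - t\<bar> < d1 \<Longrightarrow> \<bar>uxt y s - uxt x t\<bar> < e"
    "\<And>y s. \<bar>y - x\<bar> < d2 \<Longrightarrow> \<bar>s - t\<bar> < d2 \<Longrightarrow> \<bar>utx y s - utx x t\<bar> < e"
    using near[OF cont(1)] near[OF cont(2)] by blast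
  define h where "h = min (min d1 d2) (T - t) / 2"
  have h: "0 < h" "h < d1" "h < d2" "t + h < T"
    using d t by (auto simp: h_def min_def field_simps split: if_splits)
  have "\<exists>y>x. y < x + h \<and> (u (x + h) (t + h) - u (x + h) t) - (u x (t + h) - u x t)
      = (x + h - x) * (ux y (t + h) - ux y t)"
    using h t by (intro MVT2 DERIV_diff partials_on_strip_interior[OF u]) auto
  then obtain y1 where y1: "x < y1" "y1 < x + h"
    "(u (x + h) (t + h) - u (x + h) t) - (u x (t + h) - u x t) = h * (ux y1 (t + h) - ux y1 t)"
    by auto
  have "\<exists>s>t. s < t + h \<and> ux y1 (t + h) - ux y1 t = (t + h - t) * uxt y1 s"
    using h t by (intro MVT2 partials_on_strip_interior[OF ux]) auto
  then obtain s1 where s1: "t < s1" "s1 < t + h" "ux y1 (t + h) - ux y1 t = h * uxt y1 s1"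
    by auto
  have "\<exists>s>t. s < t + h \<and> (u (x + h) (t + h) - u x (t + h)) - (u (x + h) t - u x t)
      = (t + h - t) * (ut (x + h) s - ut x s)"
    using h t by (intro MVT2 DERIV_diff partials_on_strip_interior[OF u]) auto
  then obtain s2 where s2: "t < s2" "s2 < t + h"
    "(u (x + h) (t + h) - u x (t + h)) - (u (x + h) t - u x t) = h * (ut (x + h) s2 - ut x s2)"
    by auto
  have "\<exists>y>x. y < x + h \<and> ut (x + h) s2 - ut x s2 = (x + h - x) * utx y s2"
    using h t s2 by (intro MVT2 partials_on_strip_interior[OF ut]) auto
  then obtain y2 where y2: "x < y2" "y2 < x + h" "ut (x + h) s2 - ut x s2 = h * utx y2 s2"
    by auto
  have "h * (h * uxt y1 s1) = h * (h * utx y2 s2)"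
    using y1(3) s1(3) s2(3) y2(3) by (simp add: algebra_simps)
  then have "uxt y1 s1 = utx y2 s2" using h by simp
  moreover have "\<bar>uxt y1 s1 - uxt x t\<bar> < e" using h y1 s1 by (intro d) auto
  moreover have "\<bar>utx y2 s2 - utx x t\<bar> < e" using h y2 s2 by (intro d) auto
  moreover have "\<bar>uxt x t - utx x t\<bar> \<le> \<bar>uxt y1 s1 - uxt x t\<bar> + \<bar>uxt y1 s1 - utx x t\<bar>"
    by arith
  ultimately show False by (simp add: e_def)
qed

lemma continuous_on_strip_line:
  assumes "continuous_on_strip T v" and "t < T" and "continuous_on {0..t} \<alpha>"
  shows "continuous_on {0..t} (\<lambda>s. v (\<alpha> s) s)"
  using continuous_on_compose2[OF assms(1), of "{0..t}" "\<lambda>s. (\<alpha> s, s)"] assms(2,3)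
  by (force intro: continuous_intros)

text \<open>Integration of \<open>q\<^sub>t + \<sigma> q\<^sub>x\<close> along its characteristic through \<open>(x, t)\<close>. An exponential
growth rate \<open>\<kappa>\<close> of the right-hand side gains the factor \<open>1 / \<kappa>\<close>, which is what makes the uniqueness
argument close without a restriction on time.\<close>
lemma transport_bound:
  assumes q: "partials_on_strip T q qx qt" "continuous_on_strip T q" "continuous_on_strip T qt"
    and t: "0 \<le> t" "t < T" and "0 \<le> m" "0 < \<kappa>" and zero: "\<And>x. q x 0 = 0"
    and bound: "\<And>s. 0 < s \<Longrightarrow> s < t \<Longrightarrow>
      \<bar>qt (x - \<sigma> * (t - s)) s + \<sigma> * qx (x - \<sigma> * (t - s)) s\<bar> \<le> m * exp (\<kappa> * s)"
  shows "\<bar>q x t\<bar> \<le> m / \<kappa> * exp (\<kappa> * t)"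
proof -
  have "\<bar>q (x - \<sigma> * (t - t)) t - q (x - \<sigma> * (t - 0)) 0\<bar>
      \<le> m / \<kappa> * exp (\<kappa> * t) - m / \<kappa> * exp (\<kappa> * 0)"
  proof (rule increment_bound[where K = "\<lambda>s. q (x - \<sigma> * (t - s)) s" and a = 0 and b = t
        and W = "\<lambda>s. m / \<kappa> * exp (\<kappa> * s)" and w = "\<lambda>s. m * exp (\<kappa> * s)"
        and k = "\<lambda>s. qt (x - \<sigma> * (t - s)) s + \<sigma> * qx (x - \<sigma> * (t - s)) s"])
    show "continuous_on {0..t} (\<lambda>s. q (x - \<sigma> * (t - s)) s)"
      by (intro continuous_on_strip_line[OF q(2)] t continuous_intros)
    fix s assume s: "0 < s" "s < t"
    show "((\<lambda>s. m / \<kappa> * exp (\<kappa> * s)) has_real_derivative m * exp (\<kappa> * s)) (at s)"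
      using \<open>0 < \<kappa>\<close> by (auto intro!: derivative_eq_intros)
    have "((\<lambda>s. q (x - \<sigma> * (t - s)) s) has_real_derivative
       qx (x - \<sigma> * (t - s)) s * \<sigma> + qt (x - \<sigma> * (t - s)) s * 1) (at s)"
    proof (rule DERIV_two_variable_chain[where S = "{0<..<T}" and K = q and Kt = qt and \<beta> = "\<lambda>s. s"])
      show "continuous_on (UNIV \<times> {0<..<T}) (\<lambda>(x, s). qt x s)"
        using q(3) by (rule continuous_on_subset) auto
      show "((\<lambda>s. x - \<sigma> * (t - s)) has_real_derivative \<sigma>) (at s)"
        by (auto intro!: derivative_eq_intros)
    qed (use s t partials_on_strip_interior[OF q(1)] in auto)
    then show "((\<lambda>s. q (x - \<sigma> * (t - s)) s) has_real_derivative
       qt (x - \<sigma> * (t - s)) s + \<sigma> * qx (x - \<sigma> * (t - s)) s) (at s)"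
      by (simp add: algebra_simps)
    show "\<bar>qt (x - \<sigma> * (t - s)) s + \<sigma> * qx (x - \<sigma> * (t - s)) s\<bar> \<le> m * exp (\<kappa> * s)"
      by (rule bound) fact+
  qed (use t \<open>0 < \<kappa>\<close> in \<open>auto intro!: continuous_intros\<close>)
  moreover have "0 \<le> m / \<kappa>" using \<open>0 \<le> m\<close> \<open>0 < \<kappa>\<close> by simp
  ultimately show ?thesis by (simp add: zero)
qed

text \<open>The domain of dependence of the point \<open>(x0, t0)\<close>; it is compact and contains all
characteristics that end in it.\<close>
definition backward_cone :: "real \<Rightarrow> real \<Rightarrow> (real \<times> real) set" where
  "backward_cone x0 t0 = {(y, s). 0 \<le> s \<and> \<bar>y - x0\<bar> \<le> t0 - s}"

lemma compact_backward_cone: "compact (backward_cone x0 t0)"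
proof -
  have "closed (backward_cone x0 t0)"
    unfolding backward_cone_def case_prod_unfold
    by (intro closed_Collect_conj closed_Collect_le continuous_intros)
  moreover have "backward_cone x0 t0 \<subseteq> cbox (x0 - t0, 0) (x0 + t0, t0)"
    by (auto simp: backward_cone_def cbox_Pair_eq)
  ultimately show ?thesis
    by (meson bounded_cbox bounded_subset compact_eq_bounded_closed)
qed

lemma backward_cone_subset_strip: "t0 < T \<Longrightarrow> backward_cone x0 t0 \<subseteq> UNIV \<times> {0..<T}"
  by (auto simp: backward_cone_def)

lemma bounded_on_backward_cone:
  assumes "continuous_on_strip T v" "t0 < T"
  obtains R where "\<And>y s. (y, s) \<in> backward_cone x0 t0 \<Longrightarrow> \<bar>v y s\<bar> \<le> R"
proof -
  have "continuous_on (backward_cone x0 t0) (\<lambda>(x, t). v x t)"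
    using assms(1) backward_cone_subset_strip[OF assms(2)] by (rule continuous_on_subset)
  then have "compact ((\<lambda>(x, t). v x t) ` backward_cone x0 t0)"
    using compact_backward_cone by (rule compact_continuous_image)
  then obtain R where "\<forall>z \<in> (\<lambda>(x, t). v x t) ` backward_cone x0 t0. norm z \<le> R"
    using compact_imp_bounded bounded_iff by blast
  then have "\<bar>v y s\<bar> \<le> R" if "(y, s) \<in> backward_cone x0 t0" for y s
    using that by force
  then show thesis by (rule that)
qed

text \<open>Let \<open>N\<close> be the maximum of \<open>|d| exp (- \<kappa> t)\<close> over the cone. The function
\<open>q = d\<^sub>t + d\<^sub>x\<close> solves \<open>q\<^sub>t - q\<^sub>x = d\<^sub>t\<^sub>t - d\<^sub>x\<^sub>x\<close>, so two applications of the transport bound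
give \<open>N \<le> K N / \<kappa>\<^sup>2\<close>, and \<open>\<kappa> = K + 1\<close> leaves only \<open>N = 0\<close>.\<close>
lemma wave_zero_data_imp_zero:
  assumes d: "C2_on_strip_with T d dx dt dxx dxt dtx dtt"
    and zero: "\<And>x. d x 0 = 0" "\<And>x. dt x 0 = 0"
    and t0: "0 \<le> t0" "t0 < T"
    and K: "0 \<le> K" "\<And>y s. (y, s) \<in> backward_cone x0 t0 \<Longrightarrow> \<bar>dtt y s - dxx y s\<bar> \<le> K * \<bar>d y s\<bar>"
  shows "d x0 t0 = 0"
proof -
  define \<kappa> where "\<kappa> = K + 1"
  have \<kappa>: "0 < \<kappa>" "K / \<kappa> < 1" "1 / \<kappa> \<le> 1" using K by (simp_all add: \<kappa>_def)
  note D = d[unfolded C2_on_strip_with_def]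
  have in_cone: "(x0, t0) \<in> backward_cone x0 t0" using t0 by (simp add: backward_cone_def)
  have "continuous_on (backward_cone x0 t0) (\<lambda>(y, s). d y s)"
    by (rule continuous_on_subset[OF _ backward_cone_subset_strip[OF t0(2)]]) (use D in blast)
  then have "continuous_on (backward_cone x0 t0) (\<lambda>q. \<bar>d (fst q) (snd q)\<bar> * exp (- \<kappa> * snd q))"
    unfolding case_prod_unfold by (intro continuous_intros)
  from continuous_attains_sup[OF compact_backward_cone _ this] in_cone
  obtain z where z: "z \<in> backward_cone x0 t0" "\<And>q. q \<in> backward_cone x0 t0 \<Longrightarrow>
      \<bar>d (fst q) (snd q)\<bar> * exp (- \<kappa> * snd q) \<le> \<bar>d (fst z) (snd z)\<bar> * exp (- \<kappa> * snd z)"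
    by blast
  define y1 s1 where "y1 = fst z" and "s1 = snd z"
  have max: "(y1, s1) \<in> backward_cone x0 t0"
    "\<And>y s. (y, s) \<in> backward_cone x0 t0 \<Longrightarrow> \<bar>d y s\<bar> * exp (- \<kappa> * s) \<le> \<bar>d y1 s1\<bar> * exp (- \<kappa> * s1)"
    using z(1) z(2)[of "(y, s)" for y s] by (simp_all add: y1_def s1_def)
  define N where "N = \<bar>d y1 s1\<bar> * exp (- \<kappa> * s1)"
  have N: "0 \<le> N" by (simp add: N_def)
  have dN: "\<bar>d y s\<bar> \<le> N * exp (\<kappa> * s)" if "(y, s) \<in> backward_cone x0 t0" for y s
  proof -
    have "\<bar>d y s\<bar> * exp (- \<kappa> * s) \<le> N" using max(2)[OF that] by (simp add: N_def)
    then show ?thesis by (simp add: exp_minus field_simps)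
  qed
  have dx0: "dx x 0 = 0" for x
  proof -
    have "((\<lambda>y. d y 0) has_real_derivative dx x 0) (at x)"
      using D t0 by (auto simp: partials_on_strip_def)
    then show ?thesis using DERIV_unique[of "\<lambda>y. d y 0" _ x 0] zero by simp
  qed
  have q: "\<bar>dt z r + dx z r\<bar> \<le> K * N / \<kappa> * exp (\<kappa> * r)" if zr: "(z, r) \<in> backward_cone x0 t0" for z r
  proof (rule transport_bound[where q = "\<lambda>x t. dt x t + dx x t" and \<sigma> = "-1" and T = T
        and qx = "\<lambda>x t. dtx x t + dxx x t" and qt = "\<lambda>x t. dtt x t + dxt x t"])
    show "partials_on_strip T (\<lambda>x t. dt x t + dx x t) (\<lambda>x t. dtx x t + dxx x t) (\<lambda>x t. dtt x t + dxt x t)"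
      using D by (auto simp: partials_on_strip_def intro!: DERIV_add)
    show "continuous_on_strip T (\<lambda>x t. dt x t + dx x t)" "continuous_on_strip T (\<lambda>x t. dtt x t + dxt x t)"
      using D unfolding case_prod_unfold by (auto intro!: continuous_intros)
    show "0 \<le> r" "r < T" using zr t0 by (auto simp: backward_cone_def)
    show "dt x 0 + dx x 0 = 0" for x by (simp add: zero dx0)
    show "0 \<le> K * N" using K N by simp
    fix s assume s: "0 < s" "s < r"
    then have c: "(z - - 1 * (r - s), s) \<in> backward_cone x0 t0"
      using zr by (auto simp: backward_cone_def)
    \<comment> \<open>The mixed terms cancel in \<open>(d\<^sub>t + d\<^sub>x)\<^sub>t - (d\<^sub>t + d\<^sub>x)\<^sub>x\<close>.\<close>
    have "dxt y s = dtx y s" for y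
      by (rule mixed_partials_eq[of T d dx dt dxx _ _ dtt]) (use D s \<open>r < T\<close> in auto)
    then have "\<bar>dtt (z - - 1 * (r - s)) s + dxt (z - - 1 * (r - s)) s
         + - 1 * (dtx (z - - 1 * (r - s)) s + dxx (z - - 1 * (r - s)) s)\<bar>
      = \<bar>dtt (z - - 1 * (r - s)) s - dxx (z - - 1 * (r - s)) s\<bar>" by simp
    also have "\<dots> \<le> K * (N * exp (\<kappa> * s))"
      using K(2)[OF c] mult_left_mono[OF dN[OF c] K(1)] by linarith
    finally show "\<bar>dtt (z - - 1 * (r - s)) s + dxt (z - - 1 * (r - s)) s
         + - 1 * (dtx (z - - 1 * (r - s)) s + dxx (z - - 1 * (r - s)) s)\<bar> \<le> K * N * exp (\<kappa> * s)"
      by simp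
  qed fact
  have "\<bar>d y1 s1\<bar> \<le> K * N / \<kappa> / \<kappa> * exp (\<kappa> * s1)"
  proof (rule transport_bound[where q = d and \<sigma> = 1 and T = T and qx = dx and qt = dt])
    show "0 \<le> s1" "s1 < T" using max(1) t0 by (auto simp: backward_cone_def)
    show "0 \<le> K * N / \<kappa>" using K N \<kappa> by simp
    fix s assume s: "0 < s" "s < s1"
    then have "(y1 - 1 * (s1 - s), s) \<in> backward_cone x0 t0"
      using max(1) by (auto simp: backward_cone_def)
    from q[OF this]
    show "\<bar>dt (y1 - 1 * (s1 - s)) s + 1 * dx (y1 - 1 * (s1 - s)) s\<bar> \<le> K * N / \<kappa> * exp (\<kappa> * s)"
      by simp
  qed (use D zero \<kappa> in auto)
  then have "N \<le> K * N / \<kappa> / \<kappa>"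
    by (simp add: N_def exp_minus field_simps)
  also have "\<dots> = (K / \<kappa>) * (1 / \<kappa>) * N" by simp
  finally have "N * (1 - (K / \<kappa>) * (1 / \<kappa>)) \<le> 0" by (simp add: algebra_simps)
  moreover have "(K / \<kappa>) * (1 / \<kappa>) \<le> (K / \<kappa>) * 1"
    using \<kappa> K by (intro mult_left_mono) auto
  ultimately have "N \<le> 0"
    using \<kappa>(2) by (simp add: mult_le_0_iff)
  then have "N = 0" using N by simp
  with dN[OF in_cone] have "\<bar>d x0 t0\<bar> \<le> 0" by simp
  then show ?thesis by simp
qed

lemma partials_on_strip_diff:
  assumes "partials_on_strip T u ux ut" "partials_on_strip T v vx vt"
  shows "partials_on_strip T (\<lambda>x t. u x t - v x t) (\<lambda>x t. ux x t - vx x t) (\<lambda>x t. ut x t - vt x t)"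
  using assms unfolding partials_on_strip_def by (simp add: DERIV_diff)

lemma continuous_on_strip_diff:
  assumes "continuous_on_strip T u" "continuous_on_strip T v"
  shows "continuous_on_strip T (\<lambda>x t. u x t - v x t)"
  using assms unfolding case_prod_unfold by (rule continuous_on_diff)

lemma C2_on_strip_with_diff:
  assumes "C2_on_strip_with T u ux ut uxx uxt utx utt" "C2_on_strip_with T v vx vt vxx vxt vtx vtt"
  shows "C2_on_strip_with T (\<lambda>x t. u x t - v x t) (\<lambda>x t. ux x t - vx x t) (\<lambda>x t. ut x t - vt x t)
    (\<lambda>x t. uxx x t - vxx x t) (\<lambda>x t. uxt x t - vxt x t) (\<lambda>x t. utx x t - vtx x t) (\<lambda>x t. utt x t - vtt x t)"
  using assms unfolding C2_on_strip_with_def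
  by (intro conjI partials_on_strip_diff continuous_on_strip_diff) blast+

lemma C2_solution_unique:
  assumes "a \<ge> -1" and lip: "\<And>R. \<exists>L\<ge>0. \<forall>a b. \<bar>a\<bar> \<le> R \<longrightarrow> \<bar>b\<bar> \<le> R \<longrightarrow> \<bar>F a - F b\<bar> \<le> L * \<bar>a - b\<bar>"
    and u: "C2_solution a F u0 u1 T u" and v: "C2_solution a F u0 u1 T v"
    and t: "t \<in> {0..<T}"
  shows "u x t = v x t"
proof -
  obtain ux ut uxx uxt utx utt where U: "C2_on_strip_with T u ux ut uxx uxt utx utt"
    "\<And>x t. t \<in> {0..<T} \<Longrightarrow> utt x t - uxx x t = F (u x t) / (1 + \<bar>x\<bar>\<^sup>2) powr ((1 + a) / 2)"
    "\<And>x. u x 0 = u0 x" "\<And>x. ut x 0 = u1 x"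
    using u unfolding C2_solution_def by metis
  obtain vx vt vxx vxt vtx vtt where V: "C2_on_strip_with T v vx vt vxx vxt vtx vtt"
    "\<And>x t. t \<in> {0..<T} \<Longrightarrow> vtt x t - vxx x t = F (v x t) / (1 + \<bar>x\<bar>\<^sup>2) powr ((1 + a) / 2)"
    "\<And>x. v x 0 = u0 x" "\<And>x. vt x 0 = u1 x"
    using v unfolding C2_solution_def by metis
  have t': "0 \<le> t" "t < T" using t by auto
  obtain R1 where R1: "\<And>y s. (y, s) \<in> backward_cone x t \<Longrightarrow> \<bar>u y s\<bar> \<le> R1"
    using bounded_on_backward_cone[of T u t] U(1) t' unfolding C2_on_strip_with_def by blast
  obtain R2 where R2: "\<And>y s. (y, s) \<in> backward_cone x t \<Longrightarrow> \<bar>v y s\<bar> \<le> R2"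
    using bounded_on_backward_cone[of T v t] V(1) t' unfolding C2_on_strip_with_def by blast
  obtain L where L: "L \<ge> 0"
    "\<And>a b. \<bar>a\<bar> \<le> max R1 R2 \<Longrightarrow> \<bar>b\<bar> \<le> max R1 R2 \<Longrightarrow> \<bar>F a - F b\<bar> \<le> L * \<bar>a - b\<bar>"
    using lip by meson
  have "u x t - v x t = 0"
  proof (rule wave_zero_data_imp_zero[OF C2_on_strip_with_diff[OF U(1) V(1)] _ _ t' L(1)])
    fix y s assume c: "(y, s) \<in> backward_cone x t"
    then have s: "s \<in> {0..<T}" using backward_cone_subset_strip[OF t'(2), of x] by blast
    define w where "w = (1 + \<bar>y\<bar>\<^sup>2) powr ((1 + a) / 2)"
    have w: "w \<ge> 1" unfolding w_def using \<open>a \<ge> -1\<close> by (intro ge_one_powr_ge_zero) auto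
    have "utt y s - uxx y s = F (u y s) / w" "vtt y s - vxx y s = F (v y s) / w"
      unfolding w_def by (rule U(2)[OF s] V(2)[OF s])+
    then have "(utt y s - vtt y s) - (uxx y s - vxx y s) = (F (u y s) - F (v y s)) / w"
      by (simp add: diff_divide_distrib)
    then have "\<bar>(utt y s - vtt y s) - (uxx y s - vxx y s)\<bar> = \<bar>F (u y s) - F (v y s)\<bar> / w"
      using w by simp
    also have "\<dots> \<le> \<bar>F (u y s) - F (v y s)\<bar>"
      using w by (simp add: divide_le_eq mult_le_cancel_left1)
    also have "\<dots> \<le> L * \<bar>u y s - v y s\<bar>"
      using R1[OF c] R2[OF c] by (intro L) auto
    finally show "\<bar>(utt y s - vtt y s) - (uxx y s - vxx y s)\<bar> \<le> L * \<bar>u y s - v y s\<bar>" .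
  qed (use U V in auto)
  then show ?thesis by simp
qed

section \<open>Existence by contraction\<close>

lemma lipschitz_of_derivative_bound:
  fixes F F' :: "real \<Rightarrow> real"
  assumes "\<And>u. (F has_real_derivative F' u) (at u)" and "\<And>u. \<bar>u\<bar> \<le> R \<Longrightarrow> \<bar>F' u\<bar> \<le> L"
    and "\<bar>a\<bar> \<le> R" "\<bar>b\<bar> \<le> R"
  shows "\<bar>F a - F b\<bar> \<le> L * \<bar>a - b\<bar>"
  using field_differentiable_bound[of "{-R..R}" F F' L a b] assms
  by (auto simp: abs_le_iff intro: has_field_derivative_at_within)

lemma partials_on_stripI:
  assumes "has_dx u ux" "has_dt u ut"
  shows "partials_on_strip T u ux ut"
  using assms by (auto simp: partials_on_strip_def intro: has_field_derivative_at_within)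

text \<open>The fixed point is sought among bounded continuous functions on the whole plane, with the
time argument clamped to \<open>[0, T]\<close>. Then all functions are defined and continuous for all times, all
derivatives are two-sided, and the one-sided derivatives at \<open>t = 0\<close> come from restriction.
The hypothesis \<open>T * S * L \<le> 1 / 2\<close> makes the map contract by the factor \<open>1 / 2\<close>; since \<open>F 0 = 0\<close>, it
also maps the ball of radius \<open>R\<close> to itself, because the free part uses only half of the radius.\<close>
lemma semilinear_wave_existence:
  fixes F F' w w' W P P' P'' Q Q' Q'' :: "real \<Rightarrow> real"
  assumes F: "\<And>u. (F has_real_derivative F' u) (at u)" "continuous_on UNIV F'" "F 0 = 0"
    and F_le: "\<And>u. \<bar>u\<bar> \<le> R \<Longrightarrow> \<bar>F' u\<bar> \<le> L"
    and w: "\<And>x. (w has_real_derivative w' x) (at x)" "continuous_on UNIV w'" "\<And>x. 0 \<le> w x"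
    and W: "\<And>x. (W has_real_derivative w x) (at x)"
    and S: "\<And>x r. 0 \<le> r \<Longrightarrow> r \<le> T \<Longrightarrow> W (x + r) - W (x - r) \<le> 2 * S"
    and P: "\<And>x. (P has_real_derivative P' x) (at x)" "\<And>x. (P' has_real_derivative P'' x) (at x)"
      "continuous_on UNIV P''"
    and Q: "\<And>x. (Q has_real_derivative Q' x) (at x)" "\<And>x. (Q' has_real_derivative Q'' x) (at x)"
      "continuous_on UNIV Q''"
    and free_le: "\<And>x t. 0 \<le> t \<Longrightarrow> \<bar>P (x + t) + Q (x - t)\<bar> \<le> R / 2"
    and "0 < R" "0 < T" and small: "T * S * L \<le> 1 / 2"
  shows "\<exists>u ux ut uxx uxt utx utt. C2_on_strip_with T u ux ut uxx uxt utx utt \<and>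
    (\<forall>x. \<forall>t\<in>{0..<T}. utt x t - uxx x t = F (u x t) * w x) \<and>
    (\<forall>x. u x 0 = P x + Q x) \<and> (\<forall>x. ut x 0 = P' x - Q' x)"
proof -
  have cP: "continuous_on UNIV P" "continuous_on UNIV P'" "continuous_on UNIV Q" "continuous_on UNIV Q'"
    "continuous_on UNIV F" "continuous_on UNIV w"
    using P(1,2) Q(1,2) F(1) w(1) by (meson DERIV_isCont continuous_at_imp_continuous_on)+
  note cc = cP[THEN continuous_on_compose2] P(3)[THEN continuous_on_compose2]
    Q(3)[THEN continuous_on_compose2] F(2)[THEN continuous_on_compose2] w(2)[THEN continuous_on_compose2]
  have S0: "0 \<le> S" using S[of 0 0] \<open>0 < T\<close> by simp
  have L0: "0 \<le> L" using F_le[of 0] \<open>0 < R\<close> abs_ge_zero[of "F' 0"] by linarith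
  have lip: "\<bar>F y - F z\<bar> \<le> L * \<bar>y - z\<bar>" if "\<bar>y\<bar> \<le> R" "\<bar>z\<bar> \<le> R" for y z
    by (rule lipschitz_of_derivative_bound[OF F(1) _ that]) (rule F_le)
  define c where "c t = max 0 (min T t)" for t :: real
  have c: "0 \<le> c t" "c t \<le> T" for t using \<open>0 < T\<close> by (auto simp: c_def)
  have c_id: "c t = t" if "t \<in> {0..<T}" for t using that by (auto simp: c_def)
  have cont_c: "continuous_on A c" for A
    unfolding c_def by (intro continuous_intros)
  define src where "src U = (\<lambda>x t. F (apply_bcontfun U (x, t)) * w x)" for U :: "(real \<times> real) \<Rightarrow>\<^sub>C real"
  define \<Phi> where "\<Phi> U = Bcontfun (\<lambda>q. P (fst q + c (snd q)) + Q (fst q - c (snd q))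
      + duhamel (src U) (fst q) (c (snd q)))" for U
  have cont_U: "cont2 (\<lambda>x t. apply_bcontfun U (x, t))" for U :: "(real \<times> real) \<Rightarrow>\<^sub>C real"
    using continuous_on_apply_bcontfun[of UNIV U] by (simp add: case_prod_unfold)
  have cont_src: "cont2 (src U)" for U
    using cont_U[of U] unfolding src_def case_prod_unfold
    by (intro continuous_intros cc(5)[of UNIV] cc(6)[of UNIV]) auto
  have U_le: "\<bar>apply_bcontfun U z\<bar> \<le> R" if "U \<in> cball 0 R" for U :: "(real \<times> real) \<Rightarrow>\<^sub>C real" and z
    using that norm_bounded[of U z] by simp
  have shrink: "m * S * c t * L \<le> m / 2" if "0 \<le> m" for m t
  proof -
    have "m * S * c t * L = m * (c t * S * L)" by simp
    also have "\<dots> \<le> m * (T * S * L)"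
      using c S0 L0 that by (intro mult_left_mono mult_right_mono) auto
    also have "\<dots> \<le> m * (1 / 2)" using small that by (rule mult_left_mono)
    finally show ?thesis by simp
  qed
  have diff_le: "\<bar>duhamel (src U) x (c t) - duhamel (src V) x (c t)\<bar> \<le> dist U V / 2"
    if "U \<in> cball 0 R" "V \<in> cball 0 R" for U V x t
  proof -
    have "\<bar>duhamel (\<lambda>x t. src U x t - src V x t) x (c t)\<bar> \<le> (dist U V * L) * S * c t"
    proof (rule duhamel_bound[OF _ _ _ _ W S])
      show "cont2 (\<lambda>x t. src U x t - src V x t)"
        using cont_src[of U] cont_src[of V] unfolding case_prod_unfold by (intro continuous_intros)
      fix y s
      have "\<bar>src U y s - src V y s\<bar> = \<bar>F (apply_bcontfun U (y, s)) - F (apply_bcontfun V (y, s))\<bar> * w y"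
        using w(3)[of y] by (simp add: src_def abs_mult flip: left_diff_distrib)
      also have "\<dots> \<le> (L * \<bar>apply_bcontfun U (y, s) - apply_bcontfun V (y, s)\<bar>) * w y"
        using w(3) by (intro mult_right_mono lip U_le[OF that(1)] U_le[OF that(2)])
      also have "\<dots> \<le> (L * dist U V) * w y"
        using w(3) L0 dist_bounded[of U "(y, s)" V]
        by (intro mult_right_mono mult_left_mono) (auto simp: dist_real_def)
      finally show "\<bar>src U y s - src V y s\<bar> \<le> (dist U V * L) * w y" by (simp add: mult.commute)
    qed (use c[of t] L0 in auto)
    also have "\<dots> \<le> dist U V / 2" using shrink[of "dist U V" t] by (simp add: mult_ac)
    finally show ?thesis by (simp add: duhamel_diff cont_src)
  qed
  \<comment> \<open>The contraction estimate against the zero function also bounds the image of the ball.\<close>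
  have zero: "duhamel (src 0) x t = 0" for x t
  proof -
    have "src 0 = (\<lambda>x t. 0)" by (simp add: src_def F(3) fun_eq_iff)
    then show ?thesis using duhamel_diff[of "\<lambda>x t. 0" "\<lambda>x t. 0" x t] by simp
  qed
  have \<Phi>_le: "\<bar>P (x + c t) + Q (x - c t) + duhamel (src U) x (c t)\<bar> \<le> R" if "U \<in> cball 0 R" for U x t
  proof -
    have "\<bar>duhamel (src U) x (c t)\<bar> \<le> dist U 0 / 2"
      using diff_le[OF that, of 0 x t] \<open>0 < R\<close> by (simp add: zero)
    also have "\<dots> \<le> R / 2" using that by (simp add: dist_commute)
    finally show ?thesis using free_le[of "c t" x] c[of t] by linarith
  qed
  have \<Phi>: "apply_bcontfun (\<Phi> U) q = P (fst q + c (snd q)) + Q (fst q - c (snd q))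
      + duhamel (src U) (fst q) (c (snd q))" if "U \<in> cball 0 R" for U q
  proof -
    have "(\<lambda>q. P (fst q + c (snd q)) + Q (fst q - c (snd q)) + duhamel (src U) (fst q) (c (snd q))) \<in> bcontfun"
    proof (rule bcontfun_normI)
      show "continuous_on UNIV (\<lambda>q. P (fst q + c (snd q)) + Q (fst q - c (snd q)) + duhamel (src U) (fst q) (c (snd q)))"
        by (intro continuous_intros cc(1,3)[of UNIV] cont2_compose[OF cont2_duhamel(1)[OF cont_src]]
              continuous_on_compose2[OF cont_c[of UNIV]]) auto
    qed (use \<Phi>_le[OF that] in auto)
    from Bcontfun_inverse[OF this] show ?thesis by (simp add: \<Phi>_def)
  qed
  have "\<exists>!U\<in>cball 0 R. \<Phi> U = U"
  proof (rule Banach_fix)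
    show "complete (cball (0 :: (real \<times> real) \<Rightarrow>\<^sub>C real) R)" by (simp add: complete_eq_closed)
    show "\<Phi> ` cball 0 R \<subseteq> cball 0 R"
      using \<Phi>_le by (auto simp: \<Phi> intro!: norm_bound)
    show "dist (\<Phi> U) (\<Phi> V) \<le> 1 / 2 * dist U V" if "U \<in> cball 0 R" "V \<in> cball 0 R" for U V
    proof (rule dist_bound)
      fix q
      show "dist (apply_bcontfun (\<Phi> U) q) (apply_bcontfun (\<Phi> V) q) \<le> 1 / 2 * dist U V"
        using diff_le[OF that, of "fst q" "snd q"] that by (simp add: \<Phi> dist_real_def)
    qed
  qed (use \<open>0 < R\<close> in auto)
  then obtain U where U: "U \<in> cball 0 R" "\<Phi> U = U" by blast
  define h where "h = src U"
  have h: "cont2 h" unfolding h_def by (rule cont_src)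
  \<comment> \<open>Without the clamped time, this function is differentiable on the whole plane; it agrees with the
fixed point for times in \<open>[0, T]\<close>.\<close>
  define u where "u x t = P (x + t) + Q (x - t) + duhamel h x t" for x t
  define ux where "ux x t = P' (x + t) + Q' (x - t) + duhamel_dx h x t" for x t
  define ut where "ut x t = P' (x + t) - Q' (x - t) + duhamel_dt h x t" for x t
  have U_eq: "apply_bcontfun U (x, t) = u x (c t)" for x t
    using \<Phi>[OF U(1), of "(x, t)"] U(2) by (simp add: u_def h_def)
  note shift [derivative_intros] = P(1)[THEN DERIV_chain2] P(2)[THEN DERIV_chain2] Q(1)[THEN DERIV_chain2]
    Q(2)[THEN DERIV_chain2] has_dx_duhamel[OF h, rule_format] has_dt_duhamel[OF h, rule_format]
  have u_dx: "has_dx u ux" and u_dt: "has_dt u ut"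
    unfolding u_def ux_def ut_def by (auto intro!: derivative_eq_intros)
  have cont_u: "cont2 u" "cont2 ux" "cont2 ut"
    unfolding u_def ux_def ut_def case_prod_unfold
    by (intro continuous_intros cc(1-4)[of UNIV] cont2_compose[OF cont2_duhamel(1)[OF h]]
       cont2_compose[OF cont2_duhamel(2)[OF h]] cont2_compose[OF cont2_duhamel(3)[OF h]]; simp)+
  \<comment> \<open>The source inherits an \<open>x\<close>-derivative from the \<open>C\<^sup>1\<close> regularity just obtained.\<close>
  define hx where "hx x t = F' (u x (c t)) * ux x (c t) * w x + F (u x (c t)) * w' x" for x t
  have h_eq: "h x t = F (u x (c t)) * w x" for x t
    by (simp add: h_def src_def U_eq)
  have h_dx: "has_dx h hx"
    unfolding h_eq hx_def
    by (auto intro!: derivative_eq_intros F(1)[THEN DERIV_chain2] w(1) u_dx[rule_format] simp: algebra_simps)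
  have hx: "cont2 hx"
    unfolding hx_def case_prod_unfold
    by (intro continuous_intros cc(5,6,9,10)[of UNIV] cont2_compose[OF cont_u(1)] cont2_compose[OF cont_u(2)]
        continuous_on_compose2[OF cont_c[of UNIV]]; simp)
  note second = second_derivatives_duhamel[OF h hx h_dx, rule_format]
  define uxx where "uxx x t = P'' (x + t) + Q'' (x - t) + duhamel_dx hx x t" for x t
  define uxt where "uxt x t = P'' (x + t) - Q'' (x - t) + duhamel_dt hx x t" for x t
  define utt where "utt x t = P'' (x + t) + Q'' (x - t) + (h x t + duhamel_dx hx x t)" for x t
  have ux_dx: "has_dx ux uxx" and ux_dt: "has_dt ux uxt"
    unfolding ux_def uxx_def uxt_def by (auto intro!: derivative_eq_intros second)
  have ut_dx: "has_dx ut uxt" and ut_dt: "has_dt ut utt"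
    unfolding ut_def utt_def uxt_def by (auto intro!: derivative_eq_intros second)
  have cont_uxx: "cont2 uxx" "cont2 uxt" "cont2 utt"
    unfolding uxx_def uxt_def utt_def case_prod_unfold
    by (intro continuous_intros cc(7,8)[of UNIV] cont2_compose[OF cont2_duhamel(2)[OF hx]]
       cont2_compose[OF cont2_duhamel(3)[OF hx]] cont2_compose[OF h]; simp)+
  have "C2_on_strip_with T u ux ut uxx uxt uxt utt"
    unfolding C2_on_strip_with_def
    by (intro conjI partials_on_stripI u_dx u_dt ux_dx ux_dt ut_dx ut_dt
        cont_u[THEN continuous_on_subset] cont_uxx[THEN continuous_on_subset]) auto
  moreover have "utt x t - uxx x t = F (u x t) * w x" if "t \<in> {0..<T}" for x t
    using c_id[OF that] by (simp add: utt_def uxx_def h_eq)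
  moreover have "u x 0 = P x + Q x" "ut x 0 = P' x - Q' x" for x
    by (simp_all add: u_def ut_def)
  ultimately show ?thesis by blast
qed

section \<open>The power nonlinearity\<close>

text \<open>Both nonlinearities are \<open>pos_pow p u \<plusminus> pos_pow p (- u)\<close>, so that differentiability at
\<open>0\<close> has to be checked only once.\<close>
definition pos_pow :: "real \<Rightarrow> real \<Rightarrow> real" where
  "pos_pow p u = (max 0 u) powr p"

lemma DERIV_pos_pow:
  assumes "p > 1"
  shows "(pos_pow p has_real_derivative p * pos_pow (p - 1) u) (at u)"
proof -
  consider "u > 0" | "u < 0" | "u = 0" by linarith
  then show ?thesis
  proof cases
    case 1
    then have "((\<lambda>u. u powr p) has_real_derivative p * pos_pow (p - 1) u) (at u)"
      by (auto intro!: derivative_eq_intros simp: pos_pow_def max_def)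
    moreover have "eventually (\<lambda>u. u \<in> {0<..}) (nhds u)"
      using 1 by (intro eventually_nhds_in_open) auto
    then have "eventually (\<lambda>u. u powr p = pos_pow p u) (nhds u)"
      by eventually_elim (auto simp: pos_pow_def max_def)
    ultimately show ?thesis by (subst DERIV_cong_ev[OF refl _ refl]) (auto elim: eventually_mono)
  next
    case 2
    have "eventually (\<lambda>u. u \<in> {..<0}) (nhds u)"
      using 2 by (intro eventually_nhds_in_open) auto
    then have ev: "eventually (\<lambda>u. pos_pow p u = 0) (nhds u)"
      by eventually_elim (auto simp: pos_pow_def max_def)
    have "pos_pow (p - 1) u = 0" using 2 by (simp add: pos_pow_def)
    then show ?thesis using DERIV_cong_ev[OF refl ev refl, of 0] by simp
  next
    case 3
    have "((\<lambda>h. pos_pow p h / h) \<longlongrightarrow> 0) (at 0)"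
    proof (rule Lim_null_comparison)
      show "eventually (\<lambda>h. norm (pos_pow p h / h) \<le> \<bar>h\<bar> powr (p - 1)) (at 0)"
      proof (intro always_eventually allI)
        show "norm (pos_pow p h / h) \<le> \<bar>h\<bar> powr (p - 1)" for h
        proof (cases "0 < h")
          case True
          then show ?thesis by (simp add: pos_pow_def powr_diff)
        next
          case False
          then show ?thesis by (simp add: pos_pow_def)
        qed
      qed
      show "((\<lambda>h::real. \<bar>h\<bar> powr (p - 1)) \<longlongrightarrow> 0) (at 0)"
        using assms by (auto intro!: tendsto_eq_intros)
    qed
    then show ?thesis using 3 assms by (simp add: DERIV_def pos_pow_def)
  qed
qed

lemma continuous_pos_pow: "p > 0 \<Longrightarrow> continuous_on UNIV (pos_pow p)"
  unfolding pos_pow_def by (intro continuous_on_powr' continuous_intros) auto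

lemma power_nonlinearity_derivative:
  assumes "p > 1" and "F \<in> {(\<lambda>u. \<bar>u\<bar> powr (p - 1) * u), (\<lambda>u. \<bar>u\<bar> powr p)}"
  obtains F' where "\<And>u. (F has_real_derivative F' u) (at u)" "continuous_on UNIV F'" "F 0 = 0"
    "\<And>R u. \<bar>u\<bar> \<le> R \<Longrightarrow> \<bar>F' u\<bar> \<le> p * R powr (p - 1)"
proof -
  obtain \<sigma> :: real where \<sigma>: "\<bar>\<sigma>\<bar> = 1" and F: "F = (\<lambda>u. pos_pow p u + \<sigma> * pos_pow p (- u))"
  proof -
    have "(\<lambda>u. \<bar>u\<bar> powr (p - 1) * u) = (\<lambda>u. pos_pow p u + (-1) * pos_pow p (- u))"
    proof
      fix u :: real
      have "v powr (p - 1) * v = v powr p" if "0 < v" for v :: real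
        using that powr_mult_base[of v "p - 1"] by (simp add: mult.commute)
      from this[of u] this[of "- u"]
      show "\<bar>u\<bar> powr (p - 1) * u = pos_pow p u + (-1) * pos_pow p (- u)"
        by (cases u "0::real" rule: linorder_cases) (auto simp: pos_pow_def max_def)
    qed
    moreover have "(\<lambda>u. \<bar>u\<bar> powr p) = (\<lambda>u. pos_pow p u + 1 * pos_pow p (- u))"
      by (auto simp: fun_eq_iff pos_pow_def max_def)
    ultimately show thesis using assms(2) that[of "-1"] that[of 1] by auto
  qed
  define F' where "F' u = p * pos_pow (p - 1) u - \<sigma> * (p * pos_pow (p - 1) (- u))" for u
  show thesis
  proof (rule that)
    show "(F has_real_derivative F' u) (at u)" for u
      unfolding F F'_def using assms(1)
      by (auto intro!: derivative_eq_intros DERIV_pos_pow[THEN DERIV_chain2])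
    show "continuous_on UNIV F'"
      unfolding F'_def using assms(1)
      by (intro continuous_intros continuous_on_compose2[OF continuous_pos_pow[of "p - 1"], of UNIV]) auto
    show "F 0 = 0" by (simp add: F pos_pow_def)
    show "\<bar>F' u\<bar> \<le> p * R powr (p - 1)" if "\<bar>u\<bar> \<le> R" for R u
    proof -
      have "\<bar>F' u\<bar> = p * \<bar>u\<bar> powr (p - 1)"
        using assms(1) \<sigma> by (cases u "0::real" rule: linorder_cases)
          (auto simp: F'_def pos_pow_def max_def abs_mult)
      also have "\<dots> \<le> p * R powr (p - 1)"
        using that assms(1) by (intro mult_left_mono powr_mono2) auto
      finally show ?thesis .
    qed
  qed
qed

section \<open>Mass of the weight on an interval\<close>

definition weight :: "real \<Rightarrow> real \<Rightarrow> real" where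
  "weight a x = (1 + x\<^sup>2) powr (- ((1 + a) / 2))"

lemma one_plus_square_pos: "0 < 1 + x\<^sup>2" for x :: real
  by (simp add: add_pos_nonneg)

lemma weight_eq_inverse: "weight a x = 1 / (1 + \<bar>x\<bar>\<^sup>2) powr ((1 + a) / 2)"
  by (simp add: weight_def powr_minus_divide)

lemma DERIV_weight:
  "(weight a has_real_derivative - (1 + a) * x * (1 + x\<^sup>2) powr (- ((1 + a) / 2) - 1)) (at x)"
  unfolding weight_def using one_plus_square_pos[of x]
  by (auto intro!: derivative_eq_intros simp: field_simps)

lemma continuous_DERIV_weight:
  fixes a :: real
  shows
  "continuous_on UNIV (\<lambda>x. - (1 + a) * x * (1 + x\<^sup>2) powr (- ((1 + a) / 2) - 1))"
  using one_plus_square_pos by (intro continuous_intros) (auto simp: less_imp_neq[symmetric])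

lemma weight_antimono:
  assumes "a \<ge> -1" "\<bar>x\<bar> \<le> \<bar>y\<bar>"
  shows "weight a y \<le> weight a x"
  unfolding weight_def using assms one_plus_square_pos[of x]
  by (intro powr_mono2') (auto simp: abs_le_square_iff)

text \<open>The weight is even and does not increase away from the origin, so sliding an interval towards the
origin increases its mass.\<close>
lemma weight_window_le_centered:
  assumes a: "a \<ge> -1" and W: "\<And>x. (W has_real_derivative weight a x) (at x)" and "0 \<le> r"
  shows "W (x + r) - W (x - r) \<le> W r - W (- r)"
proof -
  have D: "((\<lambda>x. W (x + r) - W (x - r)) has_real_derivative weight a (x + r) - weight a (x - r)) (at x)" for x
    by (auto intro!: derivative_eq_intros W[THEN DERIV_chain2])
  show ?thesis
  proof (cases "0 \<le> x")
    case True
    have "W (x + r) - W (x - r) \<le> W (0 + r) - W (0 - r)"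
    proof (rule DERIV_nonpos_imp_nonincreasing[OF True, where f = "\<lambda>x. W (x + r) - W (x - r)"])
      fix y assume "0 \<le> y" "y \<le> x"
      then have "weight a (y + r) - weight a (y - r) \<le> 0"
        using weight_antimono[OF a, of "y - r" "y + r"] \<open>0 \<le> r\<close> by auto
      then show "\<exists>d. ((\<lambda>x. W (x + r) - W (x - r)) has_real_derivative d) (at y) \<and> d \<le> 0"
        using D by blast
    qed
    then show ?thesis by simp
  next
    case False
    have "W (x + r) - W (x - r) \<le> W (0 + r) - W (0 - r)"
    proof (rule DERIV_nonneg_imp_nondecreasing[where f = "\<lambda>x. W (x + r) - W (x - r)"])
      show "x \<le> 0" using False by simp
      fix y assume "x \<le> y" "y \<le> 0"
      then have "0 \<le> weight a (y + r) - weight a (y - r)"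
        using weight_antimono[OF a, of "y + r" "y - r"] \<open>0 \<le> r\<close> by auto
      then show "\<exists>d. ((\<lambda>x. W (x + r) - W (x - r)) has_real_derivative d) (at y) \<and> 0 \<le> d"
        using D by blast
    qed
    then show ?thesis by simp
  qed
qed

text \<open>For the three ranges of \<open>a\<close> different antiderivatives \<open>V\<close> of majorants of the weight on the
positive half-line are used. The derivative of \<open>V\<close> is taken at positive arguments only because the
majorant for \<open>-1 < a < 0\<close> is singular at \<open>0\<close>.\<close>
lemma weight_window_bound:
  assumes a: "a \<ge> -1" and W: "\<And>x. (W has_real_derivative weight a x) (at x)"
    and "0 \<le> r" "r \<le> T"
    and V: "continuous_on {0..T} V" "\<And>y. 0 < y \<Longrightarrow> y < T \<Longrightarrow> (V has_real_derivative v y) (at y)"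
      "\<And>y. 0 < y \<Longrightarrow> weight a y \<le> v y"
  shows "W (x + r) - W (x - r) \<le> 2 * (V T - V 0)"
proof -
  have T: "0 \<le> T" using assms by simp
  have weight_nonneg: "0 \<le> weight a y" for y by (simp add: weight_def)
  have half: "U T - U 0 \<le> V T - V 0" if U: "\<And>y. (U has_real_derivative weight a y) (at y)" for U
  proof -
    have "continuous_on {0..T} U"
      using U by (meson DERIV_isCont continuous_at_imp_continuous_on)
    then have "\<bar>U T - U 0\<bar> \<le> V T - V 0"
      by (rule increment_bound[OF T _ V(1) U V(2)]) (use V(3) weight_nonneg in auto)
    then show ?thesis by simp
  qed
  have mono: "W y \<le> W z" if "y \<le> z" for y z
    using that W weight_nonneg by (intro DERIV_nonneg_imp_nondecreasing[OF that]) blast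
  have even: "weight a (- y) = weight a y" for y by (simp add: weight_def)
  have "((\<lambda>y. - W (- y)) has_real_derivative weight a y) (at y)" for y
    using even[of y] by (auto intro!: derivative_eq_intros W[THEN DERIV_chain2])
  from half[OF W] half[OF this] weight_window_le_centered[OF a W \<open>0 \<le> r\<close>, of x]
    mono[of r T] mono[of "- T" "- r"] \<open>r \<le> T\<close>
  show ?thesis by simp
qed

lemma sq_powr_half_neg:
  fixes z a :: real
  assumes "0 < z"
  shows "(z\<^sup>2) powr (- ((1 + a) / 2)) = z powr (- (1 + a))"
proof -
  have "(z\<^sup>2) powr (- ((1 + a) / 2)) = (z powr 2) powr (- ((1 + a) / 2))"
    using assms by simp
  also have "\<dots> = z powr (2 * - ((1 + a) / 2))" by (rule powr_powr)
  also have "2 * - ((1 + a) / 2) = - (1 + a)" by (simp add: field_simps)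
  finally show ?thesis .
qed

text \<open>An integrable majorant for \<open>a > 0\<close>.\<close>
lemma weight_le_one_plus_powr:
  assumes "a \<ge> -1" "0 < y"
  shows "weight a y \<le> 2 powr ((1 + a) / 2) * (1 + y) powr (- (1 + a))"
proof -
  have "(1 + y)\<^sup>2 \<le> 2 * (1 + y\<^sup>2)"
    using zero_le_power2[of "1 - y"] by (simp add: power2_eq_square algebra_simps)
  then have "((1 + y)\<^sup>2 / 2) powr (- ((1 + a) / 2)) \<ge> weight a y"
    unfolding weight_def using assms by (intro powr_mono2') auto
  moreover have "((1 + y)\<^sup>2 / 2) powr (- ((1 + a) / 2)) = 2 powr ((1 + a) / 2) * (1 + y) powr (- (1 + a))"
  proof -
    have "((1 + y)\<^sup>2 / 2) powr (- ((1 + a) / 2))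
        = (1 + y)\<^sup>2 powr (- ((1 + a) / 2)) / 2 powr (- ((1 + a) / 2))"
      by (rule powr_divide)
    also have "(1 + y)\<^sup>2 powr (- ((1 + a) / 2)) = (1 + y) powr (- (1 + a))"
      using assms by (intro sq_powr_half_neg) simp
    also have "2 powr (- ((1 + a) / 2)) = inverse (2 powr ((1 + a) / 2))"
      by (rule powr_minus)
    finally show ?thesis by (simp only: divide_inverse inverse_inverse_eq mult.commute)
  qed
  ultimately show ?thesis by simp
qed

text \<open>For \<open>a < 0\<close> a singularity of this majorant at \<open>0\<close> is integrable, and its
homogeneity gives the exact power of \<open>T\<close>, also for small \<open>T\<close>.\<close>
lemma weight_le_powr:
  assumes "a \<ge> -1" "0 < y"
  shows "weight a y \<le> y powr (- (1 + a))"
proof -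
  have "weight a y \<le> (y\<^sup>2) powr (- ((1 + a) / 2))"
    unfolding weight_def using assms by (intro powr_mono2') auto
  also have "\<dots> = y powr (- (1 + a))"
    using assms sq_powr_half_neg[of y a] by simp
  finally show ?thesis .
qed

text \<open>The shift by \<open>2\<close> makes the antiderivative match \<open>ln (2 + s)\<close> in \<open>phi\<close>.\<close>
lemma weight_le_inverse_linear:
  assumes "0 < y"
  shows "weight 0 y \<le> 3 / (2 + y)"
proof -
  have "(2 + y)\<^sup>2 / 9 \<le> 1 + y\<^sup>2"
  proof -
    have "(2 + y)\<^sup>2 = 4 + 4 * y + y\<^sup>2" and "(2 * y - 1)\<^sup>2 = 4 * y\<^sup>2 - 4 * y + 1"
      by (simp_all add: power2_eq_square algebra_simps)
    then show ?thesis
      using zero_le_power2[of "2 * y - 1"] assms by simp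
  qed
  then have "weight 0 y \<le> ((2 + y)\<^sup>2 / 9) powr (- (1 / 2))"
    unfolding weight_def using assms by (simp add: powr_mono2')
  also have "\<dots> = ((2 + y) / 3) powr (- 1)"
    using assms sq_powr_half_neg[of "(2 + y) / 3" 0] by (simp add: power_divide)
  also have "\<dots> = 3 / (2 + y)" using assms by (simp add: powr_minus_divide)
  finally show ?thesis .
qed

section \<open>Bounds from the initial data\<close>

text \<open>The set where a continuous function exceeds its essential supremum is open and of measure
zero, hence empty.\<close>
lemma bounded_of_Linf_norm_finite:
  assumes "continuous_on UNIV f" and "Linf_norm f < \<infinity>"
  obtains M where "0 \<le> M" "\<And>x. \<bar>f x\<bar> \<le> M"
proof -
  obtain M where M: "esssup lborel (\<lambda>x. ereal \<bar>f x\<bar>) \<le> ereal M"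
    using assms(2) unfolding Linf_norm_def by (cases "esssup lborel (\<lambda>x. ereal \<bar>f x\<bar>)") auto
  have "AE x in lborel. ereal \<bar>f x\<bar> \<le> ereal M"
    using esssup_AE[of "\<lambda>x. ereal \<bar>f x\<bar>" lborel] by eventually_elim (rule order_trans[OF _ M])
  then have ae: "AE x in lborel. x \<notin> {x. M < \<bar>f x\<bar>}"
    by (simp add: not_less)
  have op: "open {x. M < \<bar>f x\<bar>}"
    using assms(1) by (intro open_Collect_less continuous_intros)
  then have "{x. M < \<bar>f x\<bar>} \<in> null_sets lborel"
    using ae by (subst AE_iff_null_sets) auto
  then have "negligible {x. M < \<bar>f x\<bar>}"
    by (simp add: negligible_iff_null_sets null_sets_completionI)
  then have "{x. M < \<bar>f x\<bar>} = {}"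
    using open_not_negligible[OF op] by blast
  then have "\<bar>f x\<bar> \<le> M" for x by (auto simp: not_less)
  then show thesis using that[of M] abs_ge_zero order_trans by meson
qed

lemma increment_le_of_L1_norm_finite:
  assumes g: "continuous_on UNIV g" and "L1_norm g < \<infinity>"
    and G: "\<And>x. (G has_real_derivative g x) (at x)"
  obtains M where "0 \<le> M" "\<And>x y. \<bar>G x - G y\<bar> \<le> M"
proof -
  have meas: "g \<in> borel_measurable borel"
    using g by (rule borel_measurable_continuous_onI)
  have int: "integrable lborel (\<lambda>x. \<bar>g x\<bar>)"
    using assms(2) meas by (intro integrableI_bounded) (auto simp: L1_norm_def)
  define M where "M = (\<integral>x. \<bar>g x\<bar> \<partial>lborel)"
  have ordered: "\<bar>G y - G x\<bar> \<le> M" if "x \<le> y" for x y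
  proof -
    have hg: "(g has_integral (G y - G x)) {x..y}"
      using that G by (intro fundamental_theorem_of_calculus)
        (auto simp: has_real_derivative_iff_has_vector_derivative[symmetric] intro: has_field_derivative_at_within)
    have i1: "(\<lambda>x. \<bar>g x\<bar>) integrable_on UNIV" "integral UNIV (\<lambda>x. \<bar>g x\<bar>) = M"
      using int by (simp_all add: M_def integral_lborel integrable_on_lborel)
    have i2: "(\<lambda>x. \<bar>g x\<bar>) integrable_on {x..y}"
      using g by (intro integrable_continuous_interval continuous_intros) (auto intro: continuous_on_subset)
    have "\<bar>G y - G x\<bar> = norm (integral {x..y} g)"
      using hg by (simp add: integral_unique)
    also have "\<dots> \<le> integral {x..y} (\<lambda>x. \<bar>g x\<bar>)"
      using hg i2 by (intro integral_norm_bound_integral) auto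
    also have "\<dots> \<le> M"
      unfolding i1(2)[symmetric] using i1(1) i2 by (intro integral_subset_le) auto
    finally show ?thesis .
  qed
  have "\<bar>G x - G y\<bar> \<le> M" for x y
    using ordered[of x y] ordered[of y x] by (cases "x \<le> y") (auto simp: abs_minus_commute)
  moreover have "0 \<le> M" by (simp add: M_def)
  ultimately show thesis using that by blast
qed

text \<open>D'Alembert's formula: \<open>P = (f + G) / 2\<close> and \<open>Q = (f - G) / 2\<close> with an antiderivative \<open>G\<close> of
\<open>g\<close>. Only increments of \<open>G\<close> enter \<open>P x + Q y\<close>, and the \<open>L\<^sup>1\<close> norm of \<open>g\<close> bounds them. A positive bound
\<open>M\<close> is chosen even if \<open>f\<close> and \<open>g\<close> vanish, which spares a case distinction.\<close>
lemma free_wave_data: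
  assumes "C2_real f" "g C1_differentiable_on UNIV" "Linf_norm f < \<infinity>" "L1_norm g < \<infinity>"
  obtains M P P' P'' Q Q' Q'' where "0 < M"
    "\<And>x. (P has_real_derivative P' x) (at x)" "\<And>x. (P' has_real_derivative P'' x) (at x)"
      "continuous_on UNIV P''"
    "\<And>x. (Q has_real_derivative Q' x) (at x)" "\<And>x. (Q' has_real_derivative Q'' x) (at x)"
      "continuous_on UNIV Q''"
    "\<And>x y. \<bar>P x + Q y\<bar> \<le> M" "\<And>x. P x + Q x = f x" "\<And>x. P' x - Q' x = g x"
proof -
  obtain f' where f': "\<And>x. (f has_real_derivative f' x) (at x)" "continuous_on UNIV f'"
    using assms(1) unfolding C2_real_def C1_differentiable_on_def
    by (auto simp: has_real_derivative_iff_has_vector_derivative)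
  have "deriv f = f'" using f'(1) DERIV_imp_deriv by blast
  then obtain f'' where f'': "\<And>x. (f' has_real_derivative f'' x) (at x)" "continuous_on UNIV f''"
    using assms(1) unfolding C2_real_def C1_differentiable_on_def
    by (auto simp: has_real_derivative_iff_has_vector_derivative)
  obtain g' where g': "\<And>x. (g has_real_derivative g' x) (at x)" "continuous_on UNIV g'"
    using assms(2) unfolding C1_differentiable_on_def
    by (auto simp: has_real_derivative_iff_has_vector_derivative)
  have cont: "continuous_on UNIV f" "continuous_on UNIV g"
    using f'(1) g'(1) by (meson DERIV_isCont continuous_at_imp_continuous_on)+
  obtain G where G: "\<And>x. (G has_real_derivative g x) (at x)"
    using antiderivative_exists[OF cont(2)] by blast
  obtain M1 where M1: "0 \<le> M1" "\<And>x. \<bar>f x\<bar> \<le> M1"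
    using bounded_of_Linf_norm_finite[OF cont(1) assms(3)] by blast
  obtain M2 where M2: "0 \<le> M2" "\<And>x y. \<bar>G x - G y\<bar> \<le> M2"
    using increment_le_of_L1_norm_finite[OF cont(2) assms(4) G] by blast
  show thesis
  proof (rule that[of "M1 + M2 + 1" "\<lambda>x. (f x + G x) / 2" "\<lambda>x. (f' x + g x) / 2" "\<lambda>x. (f'' x + g' x) / 2"
        "\<lambda>x. (f x - G x) / 2" "\<lambda>x. (f' x - g x) / 2" "\<lambda>x. (f'' x - g' x) / 2"])
    show "\<bar>(f x + G x) / 2 + (f y - G y) / 2\<bar> \<le> M1 + M2 + 1" for x y
      using M1(2)[of x] M1(2)[of y] M2(2)[of x y] M2(1) by (simp add: abs_le_iff field_simps)
    show "0 < M1 + M2 + 1" using M1(1) M2(1) by simp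
    show "(f x + G x) / 2 + (f x - G x) / 2 = f x" "(f' x + g x) / 2 - (f' x - g x) / 2 = g x" for x
      by (simp_all add: field_simps)
  qed (intro DERIV_cdivide DERIV_add DERIV_diff f' f'' g' G continuous_intros; simp)+
qed

section \<open>The lower bound of the lifespan\<close>

text \<open>The ball has radius \<open>2 * M * \<epsilon>\<close>, twice the bound of the free solution. On it, \<open>F\<close> has Lipschitz
constant \<open>p * (2 * M * \<epsilon>) powr (p - 1)\<close>, and the smallness condition says that \<open>T\<close> times the mass of
the weight times this constant is at most \<open>1 / 2\<close>.\<close>
lemma unique_C2_solution_exists_small_time:
  assumes "a \<ge> -1" "p > 1" and F: "F \<in> {(\<lambda>u. \<bar>u\<bar> powr (p - 1) * u), (\<lambda>u. \<bar>u\<bar> powr p)}"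
    and "0 < M" "0 < \<epsilon>" "0 < T"
    and P: "\<And>x. (P has_real_derivative P' x) (at x)" "\<And>x. (P' has_real_derivative P'' x) (at x)"
      "continuous_on UNIV P''"
    and Q: "\<And>x. (Q has_real_derivative Q' x) (at x)" "\<And>x. (Q' has_real_derivative Q'' x) (at x)"
      "continuous_on UNIV Q''"
    and free: "\<And>x y. \<bar>P x + Q y\<bar> \<le> M" "\<And>x. P x + Q x = f x" "\<And>x. P' x - Q' x = g x"
    and V: "continuous_on {0..T} V" "\<And>y. 0 < y \<Longrightarrow> y < T \<Longrightarrow> (V has_real_derivative v y) (at y)"
      "\<And>y. 0 < y \<Longrightarrow> weight a y \<le> v y"
    and small: "T * (V T - V 0) \<le> 1 / (2 * p * (2 * M) powr (p - 1)) * \<epsilon> powr (- (p - 1))"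
  shows "unique_C2_solution_exists a F (\<lambda>x. \<epsilon> * f x) (\<lambda>x. \<epsilon> * g x) T"
proof -
  obtain F' where F': "\<And>u. (F has_real_derivative F' u) (at u)" "continuous_on UNIV F'" "F 0 = 0"
    "\<And>R u. \<bar>u\<bar> \<le> R \<Longrightarrow> \<bar>F' u\<bar> \<le> p * R powr (p - 1)"
    using power_nonlinearity_derivative[OF \<open>p > 1\<close> F] by blast
  have cont_weight: "continuous_on UNIV (weight a)"
    using DERIV_weight by (meson DERIV_isCont continuous_at_imp_continuous_on)
  obtain W where W: "\<And>x. (W has_real_derivative weight a x) (at x)"
    using antiderivative_exists[OF cont_weight] by blast
  define R where "R = 2 * M * \<epsilon>"
  have R: "0 < R" using \<open>0 < M\<close> \<open>0 < \<epsilon>\<close> by (simp add: R_def)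
  have Rp: "R powr (p - 1) = (2 * M) powr (p - 1) * \<epsilon> powr (p - 1)"
    unfolding R_def using \<open>0 < M\<close> \<open>0 < \<epsilon>\<close> by (intro powr_mult)
  have "T * (V T - V 0) * (p * R powr (p - 1))
      \<le> 1 / (2 * p * (2 * M) powr (p - 1)) * \<epsilon> powr (- (p - 1)) * (p * R powr (p - 1))"
    using small \<open>p > 1\<close> by (intro mult_right_mono) auto
  also have "\<dots> = 1 / 2"
    unfolding Rp powr_minus using \<open>p > 1\<close> \<open>0 < M\<close> \<open>0 < \<epsilon>\<close> by (simp add: field_simps)
  finally have small': "T * (V T - V 0) * (p * R powr (p - 1)) \<le> 1 / 2" .
  have free_le: "\<bar>\<epsilon> * P x + \<epsilon> * Q y\<bar> \<le> R / 2" for x y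
    using mult_left_mono[OF free(1)[of x y], of \<epsilon>] \<open>0 < \<epsilon>\<close>
    by (simp add: R_def mult.commute abs_mult flip: distrib_left)
  have "\<exists>u ux ut uxx uxt utx utt. C2_on_strip_with T u ux ut uxx uxt utx utt \<and>
    (\<forall>x. \<forall>t\<in>{0..<T}. utt x t - uxx x t = F (u x t) * weight a x) \<and>
    (\<forall>x. u x 0 = \<epsilon> * P x + \<epsilon> * Q x) \<and> (\<forall>x. ut x 0 = \<epsilon> * P' x - \<epsilon> * Q' x)"
  proof (rule semilinear_wave_existence[where F' = F' and w' = "\<lambda>x. - (1 + a) * x * (1 + x\<^sup>2) powr (- ((1 + a) / 2) - 1)"
        and W = W and S = "V T - V 0" and R = R and L = "p * R powr (p - 1)" and P'' = "\<lambda>x. \<epsilon> * P'' x" and Q'' = "\<lambda>x. \<epsilon> * Q'' x"])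
    show "W (x + r) - W (x - r) \<le> 2 * (V T - V 0)" if "0 \<le> r" "r \<le> T" for x r
      by (rule weight_window_bound[OF \<open>a \<ge> -1\<close> W that V])
    show "0 \<le> weight a x" for x by (simp add: weight_def)
  qed (intro F' DERIV_cmult P Q W DERIV_weight continuous_DERIV_weight continuous_on_mult_left
      small' free_le R \<open>0 < T\<close>; assumption?)+
  then obtain u where u: "C2_solution a F (\<lambda>x. \<epsilon> * f x) (\<lambda>x. \<epsilon> * g x) T u"
    unfolding C2_solution_def weight_eq_inverse free(2,3)[symmetric]
    by (simp add: distrib_left right_diff_distrib) blast
  have lip: "\<exists>L\<ge>0. \<forall>a b. \<bar>a\<bar> \<le> R \<longrightarrow> \<bar>b\<bar> \<le> R \<longrightarrow> \<bar>F a - F b\<bar> \<le> L * \<bar>a - b\<bar>" for R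
  proof (intro exI[of _ "p * R powr (p - 1)"] conjI allI impI)
    show "0 \<le> p * R powr (p - 1)" using \<open>p > 1\<close> by simp
    show "\<bar>F a - F b\<bar> \<le> p * R powr (p - 1) * \<bar>a - b\<bar>" if "\<bar>a\<bar> \<le> R" "\<bar>b\<bar> \<le> R" for a b
      by (rule lipschitz_of_derivative_bound[OF F'(1) _ that]) (rule F'(4))
  qed
  show ?thesis
    unfolding unique_C2_solution_exists_def
    using u C2_solution_unique[OF \<open>a \<ge> -1\<close> lip _ u] by blast
qed

lemma lifespan_ge:
  assumes "0 < T" "unique_C2_solution_exists a F (\<lambda>x. \<epsilon> * f x) (\<lambda>x. \<epsilon> * g x) T"
  shows "ereal T \<le> lifespan a F f g \<epsilon>"
  unfolding lifespan_def using assms by (intro SUP_upper) auto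

lemma phi_inv_pos:
  assumes "0 < y"
  shows "0 < phi_inv y" "phi (phi_inv y) = y"
proof -
  have "y \<in> phi ` {0..}" using phi_bij_betw assms by (auto simp: bij_betw_def)
  then have "phi_inv y \<in> {0..}" "phi (phi_inv y) = y"
    unfolding phi_inv_def by (rule inv_into_into, rule f_inv_into_f)
  moreover from this have "phi_inv y \<noteq> 0" using assms by (auto simp: phi_def)
  ultimately show "0 < phi_inv y" "phi (phi_inv y) = y" by auto
qed

theorem theorem1p2:
  fixes a p :: real and f g :: "real \<Rightarrow> real"
  assumes "a \<ge> -1" and "p > 1"
    and "C2_real f" and "g C1_differentiable_on UNIV"
    and "Linf_norm f < \<infinity>" and "L1_norm g < \<infinity>"
  shows "\<exists>c>0. \<forall>F\<in>{(\<lambda>u. \<bar>u\<bar> powr (p - 1) * u), (\<lambda>u. \<bar>u\<bar> powr p)}. \<forall>\<epsilon>>0.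
    lifespan a F f g \<epsilon> \<ge>
      ereal (if a < 0 then c * \<epsilon> powr (- (p - 1) / (1 - a))
             else if a = 0 then phi_inv (c * \<epsilon> powr (- (p - 1)))
             else c * \<epsilon> powr (- (p - 1)))"
proof -
  obtain M P P' P'' Q Q' Q'' where "0 < M" and data:
    "\<And>x. (P has_real_derivative P' x) (at x)" "\<And>x. (P' has_real_derivative P'' x) (at x)"
      "continuous_on UNIV P''"
    "\<And>x. (Q has_real_derivative Q' x) (at x)" "\<And>x. (Q' has_real_derivative Q'' x) (at x)"
      "continuous_on UNIV Q''"
    "\<And>x y. \<bar>P x + Q y\<bar> \<le> M" "\<And>x. P x + Q x = f x" "\<And>x. P' x - Q' x = g x"
    using free_wave_data[OF assms(3-6)] by metis
  \<comment> \<open>The largest value of \<open>\<kappa>\<close> for which \<open>T * S * L \<le> 1 / 2\<close> follows from \<open>T * S \<le> \<kappa> * \<epsilon> powr (- (p - 1))\<close>.\<close>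
  define \<kappa> where "\<kappa> = 1 / (2 * p * (2 * M) powr (p - 1))"
  have \<kappa>: "0 < \<kappa>" using \<open>p > 1\<close> \<open>0 < M\<close> by (simp add: \<kappa>_def)
  have bound: "ereal T \<le> lifespan a F f g \<epsilon>"
    if "F \<in> {(\<lambda>u. \<bar>u\<bar> powr (p - 1) * u), (\<lambda>u. \<bar>u\<bar> powr p)}" "0 < \<epsilon>" "0 < T"
      "continuous_on {0..T} V" "\<And>y. 0 < y \<Longrightarrow> y < T \<Longrightarrow> (V has_real_derivative v y) (at y)"
      "\<And>y. 0 < y \<Longrightarrow> weight a y \<le> v y" "T * (V T - V 0) \<le> \<kappa> * \<epsilon> powr (- (p - 1))"
    for F \<epsilon> T V v
    using that unfolding \<kappa>_def
    by (intro lifespan_ge unique_C2_solution_exists_small_time[OF assms(1,2) _ \<open>0 < M\<close> _ _ data, where V = V and v = v])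
  consider "a < 0" | "a = 0" | "0 < a" by linarith
  then show ?thesis
  proof cases
    case 1
    \<comment> \<open>Equality in the smallness condition \<open>T powr (1 - a) / (- a) \<le> \<kappa> * \<epsilon> powr (- (p - 1))\<close>, solved for \<open>T\<close>.\<close>
    define c where "c = (- a * \<kappa>) powr (1 / (1 - a))"
    have "0 < c" using 1 \<kappa> by (simp add: c_def)
    moreover have "ereal (c * \<epsilon> powr (- (p - 1) / (1 - a))) \<le> lifespan a F f g \<epsilon>"
      if F: "F \<in> {(\<lambda>u. \<bar>u\<bar> powr (p - 1) * u), (\<lambda>u. \<bar>u\<bar> powr p)}" and "0 < \<epsilon>" for F \<epsilon>
    proof (rule bound[OF F \<open>0 < \<epsilon>\<close>, where V = "\<lambda>y. y powr (- a) / (- a)" and v = "\<lambda>y. y powr (- (1 + a))"])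
      define T where "T = c * \<epsilon> powr (- (p - 1) / (1 - a))"
      show T: "0 < c * \<epsilon> powr (- (p - 1) / (1 - a))" using \<open>0 < c\<close> \<open>0 < \<epsilon>\<close> by simp
      show "continuous_on {0..c * \<epsilon> powr (- (p - 1) / (1 - a))} (\<lambda>y. y powr (- a) / (- a))"
        using 1 by (intro continuous_intros continuous_on_powr') auto
      show "((\<lambda>y. y powr (- a) / (- a)) has_real_derivative y powr (- (1 + a))) (at y)" if "0 < y" for y
      proof -
        have "((\<lambda>y. y powr (- a) / (- a)) has_real_derivative y powr (- a - 1)) (at y)"
          using that 1 by (auto intro!: derivative_eq_intros)
        moreover have "- a - 1 = - (1 + a)" by simp
        ultimately show ?thesis by (simp only:)
      qed
      show "weight a y \<le> y powr (- (1 + a))" if "0 < y" for y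
        by (rule weight_le_powr[OF assms(1) that])
      have "T * (T powr (- a)) = T powr (1 - a)"
        using T by (simp add: T_def powr_mult_base)
      also have "\<dots> = (- a * \<kappa>) * \<epsilon> powr (- (p - 1))"
        unfolding T_def c_def using 1 mult_neg_pos[OF 1 \<kappa>] \<open>0 < \<epsilon>\<close> by (simp add: powr_mult powr_powr)
      finally have "T * (T powr (- a) / (- a) - 0 powr (- a) / (- a)) = \<kappa> * \<epsilon> powr (- (p - 1))"
        using 1 by (simp add: field_simps)
      then show "c * \<epsilon> powr (- (p - 1) / (1 - a)) * ((c * \<epsilon> powr (- (p - 1) / (1 - a))) powr (- a) / (- a)
          - 0 powr (- a) / (- a)) \<le> \<kappa> * \<epsilon> powr (- (p - 1))"
        by (simp add: T_def)
    qed
    ultimately show ?thesis using 1 by auto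
  next
    case 2
    \<comment> \<open>Here the majorant is \<open>3 / (2 + y)\<close>, and \<open>3 * phi T = \<kappa> * \<epsilon> powr (- (p - 1))\<close> determines \<open>T\<close>.\<close>
    have "ereal (phi_inv (\<kappa> / 3 * \<epsilon> powr (- (p - 1)))) \<le> lifespan a F f g \<epsilon>"
      if F: "F \<in> {(\<lambda>u. \<bar>u\<bar> powr (p - 1) * u), (\<lambda>u. \<bar>u\<bar> powr p)}" and "0 < \<epsilon>" for F \<epsilon>
    proof (rule bound[OF F \<open>0 < \<epsilon>\<close>, where V = "\<lambda>y. 3 * ln (2 + y)" and v = "\<lambda>y. 3 / (2 + y)"])
      define T where "T = phi_inv (\<kappa> / 3 * \<epsilon> powr (- (p - 1)))"
      have pos: "0 < \<kappa> / 3 * \<epsilon> powr (- (p - 1))" using \<kappa> \<open>0 < \<epsilon>\<close> by simp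
      show "0 < phi_inv (\<kappa> / 3 * \<epsilon> powr (- (p - 1)))" by (rule phi_inv_pos[OF pos])
      then have T: "0 < T" by (simp add: T_def)
      show "continuous_on {0..phi_inv (\<kappa> / 3 * \<epsilon> powr (- (p - 1)))} (\<lambda>y. 3 * ln (2 + y))"
        by (intro continuous_intros) auto
      show "((\<lambda>y. 3 * ln (2 + y)) has_real_derivative 3 / (2 + y)) (at y)" if "0 < y" for y
        using that by (auto intro!: derivative_eq_intros)
      show "weight a y \<le> 3 / (2 + y)" if "0 < y" for y
        using weight_le_inverse_linear[OF that] 2 by simp
      have "T * (3 * ln (2 + T) - 3 * ln (2 + 0)) \<le> 3 * phi T"
        using T by (simp add: phi_def algebra_simps)
      also have "\<dots> = \<kappa> * \<epsilon> powr (- (p - 1))"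
        unfolding T_def using phi_inv_pos(2)[OF pos] by simp
      finally show "phi_inv (\<kappa> / 3 * \<epsilon> powr (- (p - 1))) * (3 * ln (2 + phi_inv (\<kappa> / 3 * \<epsilon> powr (- (p - 1))))
          - 3 * ln (2 + 0)) \<le> \<kappa> * \<epsilon> powr (- (p - 1))"
        by (simp only: T_def)
    qed
    then show ?thesis using 2 \<kappa> by (intro exI[of _ "\<kappa> / 3"]) auto
  next
    case 3
    define B where "B = 2 powr ((1 + a) / 2)"
    have B: "0 < B" by (simp add: B_def)
    \<comment> \<open>The whole half-line carries at most the mass \<open>B / a\<close>, so \<open>T * (B / a) = \<kappa> * \<epsilon> powr (- (p - 1))\<close> is allowed.\<close>
    define c where "c = \<kappa> * a / B"
    have c: "0 < c" using 3 \<kappa> B by (simp add: c_def)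
    have "ereal (c * \<epsilon> powr (- (p - 1))) \<le> lifespan a F f g \<epsilon>"
      if F: "F \<in> {(\<lambda>u. \<bar>u\<bar> powr (p - 1) * u), (\<lambda>u. \<bar>u\<bar> powr p)}" and "0 < \<epsilon>" for F \<epsilon>
    proof (rule bound[OF F \<open>0 < \<epsilon>\<close>, where V = "\<lambda>y. - B / a * (1 + y) powr (- a)"
          and v = "\<lambda>y. B * (1 + y) powr (- (1 + a))"])
      define T where "T = c * \<epsilon> powr (- (p - 1))"
      show "0 < c * \<epsilon> powr (- (p - 1))" using c \<open>0 < \<epsilon>\<close> by simp
      then have T: "0 < T" by (simp add: T_def)
      show "continuous_on {0..c * \<epsilon> powr (- (p - 1))} (\<lambda>y. - B / a * (1 + y) powr (- a))"
        by (intro continuous_intros) auto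
      show "((\<lambda>y. - B / a * (1 + y) powr (- a)) has_real_derivative B * (1 + y) powr (- (1 + a))) (at y)"
        if "0 < y" for y
      proof -
        have "((\<lambda>y. - B / a * (1 + y) powr (- a)) has_real_derivative B * (1 + y) powr (- a - 1)) (at y)"
          using that 3 by (auto intro!: derivative_eq_intros)
        moreover have "- a - 1 = - (1 + a)" by simp
        ultimately show ?thesis by (simp only:)
      qed
      show "weight a y \<le> B * (1 + y) powr (- (1 + a))" if "0 < y" for y
        unfolding B_def by (rule weight_le_one_plus_powr[OF assms(1) that])
      have "T * (- B / a * (1 + T) powr (- a) - - B / a * (1 + 0) powr (- a)) \<le> T * (B / a)"
        using T 3 B by (intro mult_left_mono) auto
      also have "\<dots> = \<kappa> * \<epsilon> powr (- (p - 1))"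
        unfolding T_def c_def using 3 B by simp
      finally show "c * \<epsilon> powr (- (p - 1)) * (- B / a * (1 + c * \<epsilon> powr (- (p - 1))) powr (- a)
          - - B / a * (1 + 0) powr (- a)) \<le> \<kappa> * \<epsilon> powr (- (p - 1))"
        by (simp only: T_def)
    qed
    then show ?thesis using 3 c by auto
  qed
qed

end
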